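(* Let $\mathcal R$ be a non-singular equivalence relation on a standard probability space $(X,\mu)$. The map $\mathrm{MAlg}(\mathcal R,M)\to\mathrm{Sub}(\mathcal R)$ which takes a measurable subset of $\mathcal R$ to the equivalence relation it generates is continuous when both sides carry the lower $m$-topology. In particular it is Baire class one when both sides carry the strong topology (the topology induced by $d_m$).
   Context: Standard probability spaces are atomless. A countable Borel equivalence relation $\mathcal R$ on $X$ (Borel subset of $X\times X$, countable classes) is non-singular if for every Borel bijection $\varphi$ between Borel subsets of $X$ with graph contained in $\mathcal R$, $\mu(\mathrm{dom}\,\varphi)=0$ iff $\mu(\mathrm{rng}\,\varphi)=0$. Equip $\mathcal R$ with the $\sigma$-finite measure $M(A)=\int_X|A_x|\,d\mu(x)$, $A_x=\{y:(x,y)\in A\}$, and fix a finite measure $m$ on $\mathcal R$ with the same null sets as $M$. $\mathrm{MAlg}(\mathcal R,M)$ is the set of Borel subsets of $\mathcal R$ modulo $M$-null sets; its usual (strong) topology is induced by $d_m(A,B)=m(A\triangle B)$ and does not depend on $m$. The lower $m$-topology on it is the topology for which a basis of neighborhoods of $A$ is given by the sets $\{B: m(A\setminus B)<\epsilon\}$, $\epsilon>0$. $\mathrm{Sub}(\mathcal R)\subseteq\mathrm{MAlg}(\mathcal R,M)$ is the set of (classes of) Borel equivalence relations on $X$ contained in $\mathcal R$, with the subspace topologies. A map is Baire class one if preimages of open sets are $F_\sigma$. *)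

theory Defs
  imports "HOL-Probability.Probability"
begin

section \<open>Non-singular equivalence relations\<close>

text \<open>A standard Borel space is represented by a type of class \<open>polish_space\<close>; only its Borel
  sigma-algebra is used.\<close>

definition atomless :: "'a measure \<Rightarrow> bool" where
  "atomless \<mu> \<longleftrightarrow>
     (\<forall>A\<in>sets \<mu>. emeasure \<mu> A > 0 \<longrightarrow>
        (\<exists>B\<in>sets \<mu>. B \<subseteq> A \<and> 0 < emeasure \<mu> B \<and> emeasure \<mu> B < emeasure \<mu> A))"

definition standard_prob_space :: "'a::polish_space measure \<Rightarrow> bool" where
  "standard_prob_space \<mu> \<longleftrightarrow>
     prob_space \<mu> \<and> sets \<mu> = sets (borel :: 'a measure) \<and> atomless \<mu>"

definition countable_borel_equiv :: "('a::polish_space \<times> 'a) set \<Rightarrow> bool" where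
  "countable_borel_equiv R \<longleftrightarrow>
     R \<in> sets borel \<and> equiv UNIV R \<and> (\<forall>x. countable (R `` {x}))"

definition nonsingular :: "'a::polish_space measure \<Rightarrow> ('a \<times> 'a) set \<Rightarrow> bool" where
  "nonsingular \<mu> R \<longleftrightarrow>
     (\<forall>A B. \<forall>\<phi> :: 'a \<Rightarrow> 'a.
        A \<in> sets borel \<and> B \<in> sets borel \<and> bij_betw \<phi> A B \<and>
        \<phi> \<in> measurable (restrict_space borel A) borel \<and> (\<forall>x\<in>A. (x, \<phi> x) \<in> R)
        \<longrightarrow> (emeasure \<mu> A = 0 \<longleftrightarrow> emeasure \<mu> B = 0))"

text \<open>The measure \<open>M(A) = \<integral> |A\<^sub>x| d\<mu>(x)\<close> on the Borel subsets of \<open>R\<close>.\<close>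

definition rel_measure ::
    "'a::polish_space measure \<Rightarrow> ('a \<times> 'a) set \<Rightarrow> ('a \<times> 'a) measure" where
  "rel_measure \<mu> R =
     measure_of R {A \<in> sets borel. A \<subseteq> R}
       (\<lambda>A. \<integral>\<^sup>+ x. emeasure (count_space UNIV) (A `` {x}) \<partial>\<mu>)"

lemma sets_rel_measure:
  assumes "R \<in> sets borel"
  shows "sets (rel_measure \<mu> R) = {A \<in> sets borel. A \<subseteq> R}"
proof -
  have "sets (restrict_space borel R) = {A \<in> sets borel. A \<subseteq> R}"
    using assms by (auto simp: sets_restrict_space_iff)
  then have "sigma_algebra R {A \<in> sets borel. A \<subseteq> R}"
    using sets.sigma_algebra_axioms[of "restrict_space borel R"] by (simp add: space_restrict_space)
  moreover have "{A \<in> sets borel. A \<subseteq> R} \<subseteq> Pow R" by auto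
  ultimately show ?thesis
    unfolding rel_measure_def
    by (simp add: sets_measure_of sigma_algebra.sigma_sets_eq)
qed


section \<open>The measure algebra and its topologies\<close>

text \<open>For measurable \<open>E\<close>, \<open>mclass N E\<close> is the class of \<open>E\<close> modulo \<open>N\<close>-null sets.
  Formulating it with \<open>AE\<close> lets it be applied to a generated equivalence relation, whose Borel
  measurability is a theorem (Lusin-Novikov), before that theorem is available.\<close>

definition mclass :: "'b measure \<Rightarrow> 'b set \<Rightarrow> 'b set set" where
  "mclass N E = {B \<in> sets N. AE p in N. p \<in> B \<longleftrightarrow> p \<in> E}"

definition malg :: "'b measure \<Rightarrow> 'b set set set" where
  "malg N = mclass N ` sets N"

text \<open>The choice of representatives is immaterial (lemmas \<open>lower_excess_mclass\<close> and
  \<open>malg_dist_mclass\<close>); it is made by a choice operator so that \<open>malg_dist m\<close> is nonnegative and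
  symmetric for all arguments, as \<^locale>\<open>Metric_space\<close> requires.\<close>

definition rep :: "'b set set \<Rightarrow> 'b set" where
  "rep a = (SOME A. A \<in> a)"

definition lower_excess :: "'b measure \<Rightarrow> 'b set set \<Rightarrow> 'b set set \<Rightarrow> real" where
  "lower_excess m a b = measure m (rep a - rep b)"

definition malg_dist :: "'b measure \<Rightarrow> 'b set set \<Rightarrow> 'b set set \<Rightarrow> real" where
  "malg_dist m a b = measure m (sym_diff (rep a) (rep b))"

definition lower_topology :: "'b set set set \<Rightarrow> 'b measure \<Rightarrow> 'b set set topology" where
  "lower_topology \<A> m =
     topology (\<lambda>U. U \<subseteq> \<A> \<and>
       (\<forall>a\<in>U. \<exists>\<epsilon>>0. {b \<in> \<A>. lower_excess m a b < \<epsilon>} \<subseteq> U))"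

definition strong_topology :: "'b set set set \<Rightarrow> 'b measure \<Rightarrow> 'b set set topology" where
  "strong_topology \<A> m = Metric_space.mtopology \<A> (malg_dist m)"

lemma mclass_self: "A \<in> sets N \<Longrightarrow> A \<in> mclass N A"
  by (simp add: mclass_def)

lemma mclass_cong:
  assumes "sets N = sets m" "null_sets N = null_sets m"
  shows "mclass N = mclass m"
proof -
  have "ae_filter N = ae_filter m"
    using assms sets_eq_imp_space_eq[OF assms(1)] by (simp add: ae_filter_def)
  then show ?thesis by (intro ext) (simp only: mclass_def assms(1))
qed

lemma rep_mclass: "A \<in> sets N \<Longrightarrow> rep (mclass N A) \<in> mclass N A"
  unfolding rep_def by (rule someI) (rule mclass_self)

lemma mclass_eq_iff:
  assumes "A \<in> sets N"
  shows "mclass N A = mclass N E \<longleftrightarrow> (AE p in N. p \<in> A \<longleftrightarrow> p \<in> E)"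
proof
  assume "mclass N A = mclass N E"
  with mclass_self[OF assms] have "A \<in> mclass N E" by blast
  then show "AE p in N. p \<in> A \<longleftrightarrow> p \<in> E"
    by (simp add: mclass_def)
next
  assume "AE p in N. p \<in> A \<longleftrightarrow> p \<in> E"
  then have "(AE p in N. p \<in> B \<longleftrightarrow> p \<in> A) \<longleftrightarrow> (AE p in N. p \<in> B \<longleftrightarrow> p \<in> E)" for B
    by (auto elim: AE_mp)
  then show "mclass N A = mclass N E" by (simp add: mclass_def)
qed

lemma lower_excess_mclass:
  assumes "A \<in> sets m" "B \<in> sets m"
  shows "lower_excess m (mclass m A) (mclass m B) = measure m (A - B)"
  unfolding lower_excess_def
proof (rule measure_eq_AE)
  show "AE p in m. p \<in> rep (mclass m A) - rep (mclass m B) \<longleftrightarrow> p \<in> A - B"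
    using assms[THEN rep_mclass] unfolding mclass_def by auto
qed (use assms assms[THEN rep_mclass] in \<open>auto simp: mclass_def\<close>)

lemma malg_dist_mclass:
  assumes "A \<in> sets m" "B \<in> sets m"
  shows "malg_dist m (mclass m A) (mclass m B) = measure m (sym_diff A B)"
  unfolding malg_dist_def
proof (rule measure_eq_AE)
  show "AE p in m. p \<in> sym_diff (rep (mclass m A)) (rep (mclass m B)) \<longleftrightarrow> p \<in> sym_diff A B"
    using assms[THEN rep_mclass] unfolding mclass_def by auto
qed (use assms assms[THEN rep_mclass] in \<open>auto simp: mclass_def\<close>)

lemma openin_lower_topology:
  "openin (lower_topology \<A> m) U \<longleftrightarrow>
     U \<subseteq> \<A> \<and> (\<forall>a\<in>U. \<exists>\<epsilon>>0. {b \<in> \<A>. lower_excess m a b < \<epsilon>} \<subseteq> U)"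
proof -
  have "istopology (\<lambda>U. U \<subseteq> \<A> \<and>
       (\<forall>a\<in>U. \<exists>\<epsilon>>0. {b \<in> \<A>. lower_excess m a b < \<epsilon>} \<subseteq> U))"
    unfolding istopology_def
  proof (intro conjI allI impI; (elim conjE)?)
    fix S T
    assume S: "\<forall>a\<in>S. \<exists>\<epsilon>>0. {b \<in> \<A>. lower_excess m a b < \<epsilon>} \<subseteq> S"
      and T: "\<forall>a\<in>T. \<exists>\<epsilon>>0. {b \<in> \<A>. lower_excess m a b < \<epsilon>} \<subseteq> T"
    show "\<forall>a\<in>S \<inter> T. \<exists>\<epsilon>>0. {b \<in> \<A>. lower_excess m a b < \<epsilon>} \<subseteq> S \<inter> T"
    proof
      fix a assume "a \<in> S \<inter> T"
      then obtain d e where "d > 0" "{b \<in> \<A>. lower_excess m a b < d} \<subseteq> S"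
        "e > 0" "{b \<in> \<A>. lower_excess m a b < e} \<subseteq> T"
        using S T by (meson IntD1 IntD2)
      then show "\<exists>\<epsilon>>0. {b \<in> \<A>. lower_excess m a b < \<epsilon>} \<subseteq> S \<inter> T"
        by (intro exI[of _ "min d e"]) auto
    qed
  next
    fix \<K>
    assume K: "\<forall>K\<in>\<K>. K \<subseteq> \<A> \<and>
      (\<forall>a\<in>K. \<exists>\<epsilon>>0. {b \<in> \<A>. lower_excess m a b < \<epsilon>} \<subseteq> K)"
    show "\<forall>a\<in>\<Union>\<K>. \<exists>\<epsilon>>0. {b \<in> \<A>. lower_excess m a b < \<epsilon>} \<subseteq> \<Union>\<K>"
    proof
      fix a assume "a \<in> \<Union>\<K>"
      then obtain K where "K \<in> \<K>" "a \<in> K" by auto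
      then obtain e where "e > 0" "{b \<in> \<A>. lower_excess m a b < e} \<subseteq> K"
        using K by meson
      then show "\<exists>\<epsilon>>0. {b \<in> \<A>. lower_excess m a b < \<epsilon>} \<subseteq> \<Union>\<K>"
        using \<open>K \<in> \<K>\<close> by (intro exI[of _ e]) auto
    qed
  qed auto
  then show ?thesis by (simp add: lower_topology_def topology_inverse')
qed

lemma (in finite_measure) openin_lower_nbhd:
  assumes "a \<in> malg M"
  shows "openin (lower_topology (malg M) M) {b \<in> malg M. lower_excess M a b < \<epsilon>}"
  unfolding openin_lower_topology
proof (intro conjI ballI)
  fix b assume b: "b \<in> {b \<in> malg M. lower_excess M a b < \<epsilon>}"
  have tri: "lower_excess M a c \<le> lower_excess M a b + lower_excess M b c"
    if "c \<in> malg M" for c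
  proof -
    obtain A B C where "a = mclass M A" "b = mclass M B" "c = mclass M C"
      and sets: "A \<in> sets M" "B \<in> sets M" "C \<in> sets M"
      using assms b \<open>c \<in> malg M\<close> unfolding malg_def by blast
    moreover have "measure M (A - C) \<le> measure M ((A - B) \<union> (B - C))"
      using sets by (intro finite_measure_mono) auto
    moreover have "\<dots> \<le> measure M (A - B) + measure M (B - C)"
      using sets by (intro measure_Un_le) auto
    ultimately show ?thesis by (simp add: lower_excess_mclass)
  qed
  show "\<exists>\<delta>>0. {c \<in> malg M. lower_excess M b c < \<delta>} \<subseteq> {b \<in> malg M. lower_excess M a b < \<epsilon>}"
    using b tri by (intro exI[of _ "\<epsilon> - lower_excess M a b"]) force
qed auto

lemma (in finite_measure) Metric_space_malg: "Metric_space (malg M) (malg_dist M)"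
proof
  show "0 \<le> malg_dist M a b" for a b
    by (simp add: malg_dist_def)
  show "malg_dist M a b = malg_dist M b a" for a b
    by (simp add: malg_dist_def Un_commute)
  show "malg_dist M a b = 0 \<longleftrightarrow> a = b" if "a \<in> malg M" "b \<in> malg M" for a b
  proof -
    obtain A B where *: "a = mclass M A" "b = mclass M B" "A \<in> sets M" "B \<in> sets M"
      using \<open>a \<in> malg M\<close> \<open>b \<in> malg M\<close> unfolding malg_def by blast
    then have "malg_dist M a b = 0 \<longleftrightarrow> sym_diff A B \<in> null_sets M"
      by (auto simp: malg_dist_mclass null_sets_def emeasure_eq_measure)
    also have "\<dots> \<longleftrightarrow> (AE p in M. p \<notin> sym_diff A B)"
      using * by (intro AE_iff_null_sets) auto
    also have "\<dots> \<longleftrightarrow> (AE p in M. p \<in> A \<longleftrightarrow> p \<in> B)"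
      by (intro AE_cong) auto
    finally show ?thesis using * by (simp add: mclass_eq_iff)
  qed
  show "malg_dist M a c \<le> malg_dist M a b + malg_dist M b c"
    if abc: "a \<in> malg M" "b \<in> malg M" "c \<in> malg M" for a b c
  proof -
    obtain A B C where "a = mclass M A" "b = mclass M B" "c = mclass M C"
      and sets: "A \<in> sets M" "B \<in> sets M" "C \<in> sets M"
      using abc unfolding malg_def by blast
    moreover have "measure M (sym_diff A C) \<le> measure M (sym_diff A B \<union> sym_diff B C)"
      using sets by (intro finite_measure_mono) auto
    moreover have "\<dots> \<le> measure M (sym_diff A B) + measure M (sym_diff B C)"
      using sets by (intro measure_Un_le) auto
    ultimately show ?thesis by (simp add: malg_dist_mclass)
  qed
qed


section \<open>Subrelations and the generated equivalence relation\<close>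

definition Sub :: "'a::polish_space measure \<Rightarrow> ('a \<times> 'a) set \<Rightarrow> ('a \<times> 'a) set set set" where
  "Sub \<mu> R = mclass (rel_measure \<mu> R) ` {S \<in> sets borel. equiv UNIV S \<and> S \<subseteq> R}"

definition generated_equiv :: "('a \<times> 'a) set \<Rightarrow> ('a \<times> 'a) set" where
  "generated_equiv A = \<Inter>{S. equiv UNIV S \<and> A \<subseteq> S}"

text \<open>The map induced on classes; \<open>the_elem\<close> yields the common value over all representatives.\<close>

definition generate_map ::
    "'a::polish_space measure \<Rightarrow> ('a \<times> 'a) set \<Rightarrow> ('a \<times> 'a) set set \<Rightarrow> ('a \<times> 'a) set set" where
  "generate_map \<mu> R c = the_elem ((\<lambda>A. mclass (rel_measure \<mu> R) (generated_equiv A)) ` c)"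

definition baire_class_one :: "'b topology \<Rightarrow> 'c topology \<Rightarrow> ('b \<Rightarrow> 'c) \<Rightarrow> bool" where
  "baire_class_one X Y f \<longleftrightarrow>
     f \<in> topspace X \<rightarrow> topspace Y \<and>
     (\<forall>U. openin Y U \<longrightarrow> fsigma_in X {x \<in> topspace X. f x \<in> U})"

end

theory Submission
  imports Defs
begin

text \<open>If \<open>m (A - B n)\<close> tends to \<open>0\<close> fast enough, then by Borel--Cantelli almost every point of \<open>A\<close> is
  eventually in \<open>B n\<close>. By non-singularity the exceptional null set lies over an \<open>R\<close>-invariant null
  set, and off the latter each finite path in \<open>A\<close> is eventually a path in \<open>B n\<close>; hence almost every
  point of the relation generated by \<open>A\<close> is eventually in the one generated by \<open>B n\<close>. Since \<open>m\<close> is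
  finite, this is continuity for the lower topology.

  The Lusin--Novikov theorem is needed only modulo null sets. As \<open>m\<close> is a finite Borel measure and
  the projections are countable-to-one on \<open>R\<close>, every set of positive \<open>m\<close>-measure contains a compact
  set of positive measure that is the graph of an injective map, and such graphs exhaust \<open>R\<close> up to an
  \<open>m\<close>-null set. That an \<open>m\<close>-null set projects into a \<open>\<mu>\<close>-null set follows from Choquet's
  capacitability theorem.\<close>


section \<open>Analytic sets and capacitability\<close>

text \<open>The lower topology is coarser than the strong one, so lower continuity says nothing
  directly about preimages of metric balls. They are reached because \<open>malg_dist\<close> is the
  sum of the two excesses: for fixed \<open>a\<close>, a bound on \<open>lower_excess m a b\<close>
  defines a lower open set of \<open>b\<close>, and a weak bound on
  \<open>lower_excess m b a\<close> a lower closed one. Both are F-sigma for the strong topology,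
  and separability leaves countably many balls to treat.

  Compactness is what makes graphs usable. A continuous injection on a compact set has a continuous
  inverse, so a compact graph belongs to a continuous map: it can be fed to
  \<open>nonsingular\<close>, and composing with it amounts to taking a preimage. Projections of
  general Borel sets are only analytic, so their nullness is tested on compact subsets.\<close>

instance prod :: (polish_space, polish_space) polish_space ..

text \<open>Projections of closed sets along the Baire space. The type \<open>nat discrete\<close>
  gives sequences the product of discrete topologies, so that \<open>F\<close> lies in a polish
  space when \<open>'b\<close> is polish.\<close>

definition suslin :: "'b::metric_space set \<Rightarrow> bool" where
  "suslin Z \<longleftrightarrow> (\<exists>F :: ('b \<times> (nat \<Rightarrow> nat discrete)) set. closed F \<and> Z = fst ` F)"

lemma suslin_closed: "closed Z \<Longrightarrow> suslin Z"
  unfolding suslin_def by (intro exI[of _ "Z \<times> UNIV"]) (auto intro: closed_Times)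

lemma continuous_on_snd_coordinate:
  "continuous_on UNIV (\<lambda>p :: 'b::topological_space \<times> ('i \<Rightarrow> 'c::topological_space). snd p k)"
  by (rule continuous_on_compose2[OF continuous_on_product_coordinates continuous_on_snd])
     (auto intro: continuous_on_id)

lemma continuous_on_fst_reindex:
  "continuous_on UNIV
     (\<lambda>p :: 'b::topological_space \<times> ('i \<Rightarrow> 'c::topological_space). (fst p, \<lambda>n. snd p (g n)))"
  by (intro continuous_on_Pair continuous_on_fst continuous_on_id
      continuous_on_coordinatewise_then_product continuous_on_snd_coordinate)

text \<open>One sequence codes countably many: \<phi> i reads off row i of the array coded by
  \<open>prod_encode\<close>, so a single closed set holds all the witnesses at once.\<close>

lemma suslin_INT:
  fixes Z :: "nat \<Rightarrow> 'b::metric_space set"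
  assumes "\<And>i. suslin (Z i)"
  shows "suslin (\<Inter>i. Z i)"
proof -
  obtain F :: "nat \<Rightarrow> ('b \<times> (nat \<Rightarrow> nat discrete)) set"
    where F: "\<And>i. closed (F i)" "\<And>i. Z i = fst ` F i"
    using assms unfolding suslin_def by metis
  define \<phi> where "\<phi> i p = (fst p, \<lambda>n. snd p (prod_encode (i, n)))"
    for i and p :: "'b \<times> (nat \<Rightarrow> nat discrete)"
  have cont: "continuous_on UNIV (\<phi> i)" for i
    unfolding \<phi>_def by (rule continuous_on_fst_reindex)
  have "(\<Inter>i. Z i) = fst ` (\<Inter>i. \<phi> i -` F i)"
  proof safe
    fix z assume "z \<in> (\<Inter>i. Z i)"
    then have "\<forall>i. \<exists>\<alpha>. (z, \<alpha>) \<in> F i" using F(2) by force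
    then obtain \<alpha> where "\<And>i. (z, \<alpha> i) \<in> F i" by metis
    then have "(z, \<lambda>k. \<alpha> (fst (prod_decode k)) (snd (prod_decode k))) \<in> (\<Inter>i. \<phi> i -` F i)"
      by (simp add: \<phi>_def)
    then show "z \<in> fst ` (\<Inter>i. \<phi> i -` F i)" by force
  next
    fix a b i assume "(a, b) \<in> (\<Inter>i. \<phi> i -` F i)"
    then have "\<phi> i (a, b) \<in> F i" by auto
    then show "fst (a, b) \<in> Z i" unfolding F(2) \<phi>_def by force
  qed
  moreover have "closed (\<Inter>i. \<phi> i -` F i)"
    using F(1) cont by (intro closed_INT ballI closed_vimage) auto
  ultimately show ?thesis unfolding suslin_def by blast
qed

text \<open>Entry 0 of the sequence names the index of the member, the other entries are its
  witness. As that entry is discrete, the condition splits into clopen cases and stays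
  closed.\<close>

lemma suslin_UN:
  fixes Z :: "nat \<Rightarrow> 'b::metric_space set"
  assumes "\<And>i. suslin (Z i)"
  shows "suslin (\<Union>i. Z i)"
proof -
  obtain F :: "nat \<Rightarrow> ('b \<times> (nat \<Rightarrow> nat discrete)) set"
    where F: "\<And>i. closed (F i)" "\<And>i. Z i = fst ` F i"
    using assms unfolding suslin_def by metis
  define \<phi> where "\<phi> p = (fst p, \<lambda>n. snd p (Suc n))" for p :: "'b \<times> (nat \<Rightarrow> nat discrete)"
  define G where "G = {p. \<phi> p \<in> F (of_discrete (snd p 0))}"
  have cont: "continuous_on UNIV \<phi>"
    unfolding \<phi>_def by (rule continuous_on_fst_reindex)
  have c0: "continuous_on UNIV (\<lambda>p :: 'b \<times> (nat \<Rightarrow> nat discrete). snd p 0)"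
    by (rule continuous_on_snd_coordinate)
  have "- G = (\<Union>i. (\<lambda>p. snd p 0) -` {discrete i} \<inter> \<phi> -` (- F i))"
    by (auto simp: G_def of_discrete_inverse discrete_inverse) 
  moreover have "open ((\<lambda>p. snd p 0) -` {discrete i} \<inter> \<phi> -` (- F i))" for i
    using F(1) cont c0 by (intro open_Int open_vimage) (auto simp: open_discrete)
  ultimately have "closed G" by (simp add: closed_def open_UN)
  moreover have "(\<Union>i. Z i) = fst ` G"
  proof safe
    fix z i assume "z \<in> Z i"
    then obtain \<alpha> where "(z, \<alpha>) \<in> F i" using F(2) by force
    then have "(z, case_nat (discrete i) \<alpha>) \<in> G"
      by (simp add: G_def \<phi>_def discrete_inverse)
    then show "z \<in> fst ` G" by force
  next
    fix a b assume "(a, b) \<in> G"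
    then show "fst (a, b) \<in> (\<Union>i. Z i)" unfolding F(2) G_def \<phi>_def by force
  qed
  ultimately show ?thesis unfolding suslin_def by blast
qed

lemma borel_suslin:
  fixes Z :: "'b::metric_space set"
  assumes "Z \<in> sets borel"
  shows "suslin Z"
proof -
  have "Z \<in> sigma_sets UNIV {S. open S}"
    using assms by (simp add: borel_def)
  \<comment> \<open>Suslin sets are not closed under complements; carrying the complement along
    turns a complement into a swap.\<close>
  then have "suslin Z \<and> suslin (- Z)"
  proof induction
    case (Basic S)
    then have "open S" by simp
    have "fsigma_in euclidean S"
      using \<open>open S\<close> by (intro open_imp_fsigma_in metrizable_space_euclidean) auto
    then obtain F :: "nat \<Rightarrow> 'b set" where "\<And>i. closed (F i)" "S = (\<Union>i. F i)"
      unfolding fsigma_in_ascending by auto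
    then have "suslin S" by (simp add: suslin_UN suslin_closed)
    with \<open>open S\<close> show ?case by (blast intro: suslin_closed closed_Compl)
  next
    case Empty
    then show ?case by (auto intro: suslin_closed)
  next
    case (Compl a)
    then show ?case by (simp add: Compl_eq_Diff_UNIV[symmetric])
  next
    case (Union a)
    then show ?case by (auto simp: intro!: suslin_UN suslin_INT)
  qed
  then show ?thesis ..
qed

text \<open>Choquet's capacitability theorem for the capacity \<open>E \<mapsto> \<mu>\<^sup>*(p E)\<close>: cut \<open>F\<close> down to finitely many
  balls of radius \<open>1 / (n + 1)\<close> at step \<open>n\<close>, losing little outer measure.\<close>

lemma outer_image_compact:
  fixes \<mu> :: "'a::metric_space measure" and p :: "'b::polish_space \<Rightarrow> 'a"
  assumes fin: "finite_measure \<mu>" and sets: "sets \<mu> = sets borel"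
    and F: "closed F" and p: "continuous_on UNIV p"
    and pos: "outer_measure_of \<mu> (p ` F) > 0"
  obtains K where "compact K" "K \<subseteq> F" "emeasure \<mu> (p ` K) > 0"
proof -
  interpret finite_measure \<mu> by fact
  have sp: "space \<mu> = UNIV" using sets sets_eq_imp_space_eq by fastforce
  obtain c where c: "0 < c" "c < outer_measure_of \<mu> (p ` F)" using pos dense by blast
  obtain D :: "'b set" where D: "countable D" "\<And>X. open X \<Longrightarrow> X \<noteq> {} \<Longrightarrow> \<exists>d\<in>D. d \<in> X"
    using countable_dense_exists by blast
  have "D \<noteq> {}" using D(2)[of UNIV] by auto
  define q where "q = from_nat_into D"
  have q: "\<exists>i. dist (q i) x < e" if "e > 0" for x e
  proof -
    obtain d where "d \<in> D" "d \<in> ball x e" using D(2)[of "ball x e"] \<open>e > 0\<close> by auto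
    moreover obtain i where "q i = d"
      using from_nat_into_surj[OF D(1) \<open>d \<in> D\<close>] unfolding q_def by auto
    ultimately show ?thesis by (auto simp: dist_commute)
  qed
  define B where "B n k = (\<Union>i\<le>(k::nat). cball (q i) (1 / real (Suc n)))" for n k
  have "\<exists>G. \<forall>n. (closed (G n) \<and> G n \<subseteq> F \<and> c < outer_measure_of \<mu> (p ` G n))
     \<and> (G (Suc n) \<subseteq> G n \<and> (\<exists>k. G (Suc n) \<subseteq> B n k))"
  proof (rule dependent_nat_choice)
    show "\<exists>x. closed x \<and> x \<subseteq> F \<and> c < outer_measure_of \<mu> (p ` x)" using F c by blast
  next
    fix G n assume G: "closed G \<and> G \<subseteq> F \<and> c < outer_measure_of \<mu> (p ` G)"
    have "(\<Union>k. p ` (G \<inter> B n k)) = p ` G"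
    proof -
      have "\<exists>k. x \<in> B n k" for x
        using q[of "1 / real (Suc n)" x] unfolding B_def by (force simp: less_eq_real_def)
      then show ?thesis by blast
    qed
    \<comment> \<open>Outer measure is continuous along increasing unions of arbitrary sets; the
      images are not known to be measurable.\<close>
    moreover have "(SUP k. outer_measure_of \<mu> (p ` (G \<inter> B n k))) = outer_measure_of \<mu> (\<Union>k. p ` (G \<inter> B n k))"
      by (intro SUP_outer_measure_of_incseq) (auto simp: sp incseq_def B_def intro: order_trans)
    ultimately have "c < (SUP k. outer_measure_of \<mu> (p ` (G \<inter> B n k)))" using G by simp
    then obtain k where "c < outer_measure_of \<mu> (p ` (G \<inter> B n k))" by (auto simp: less_SUP_iff)
    moreover have "closed (G \<inter> B n k)" using G unfolding B_def by (intro closed_Int closed_UN) auto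
    ultimately show "\<exists>y. (closed y \<and> y \<subseteq> F \<and> c < outer_measure_of \<mu> (p ` y)) \<and> y \<subseteq> G \<and> (\<exists>k. y \<subseteq> B n k)"
      using G by (intro exI[of _ "G \<inter> B n k"]) auto
  qed
  then obtain G where G: "\<And>n. closed (G n)" "\<And>n. G n \<subseteq> F" "\<And>n. c < outer_measure_of \<mu> (p ` G n)"
    "\<And>n. G (Suc n) \<subseteq> G n" "\<And>n. \<exists>k. G (Suc n) \<subseteq> B n k" by blast
  have dec: "decseq G" using G(4) by (rule decseq_SucI)
  \<comment> \<open>Almost containment in every \<open>G n\<close> already gives relative
    compactness. This form covers both \<open>K\<close> and the range of a sequence with
    \<open>u n\<close> in \<open>G n\<close>, of which only finitely many terms lie outside a given
    \<open>G n\<close>.\<close>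
  have compact_lim: "compact (closure S)" if S: "\<And>n. finite (S - G n)" for S
    unfolding compact_eq_totally_bounded
  proof (intro conjI allI impI)
    show "Topological_Spaces.complete (closure S)" by (simp add: complete_eq_closed)
    fix e :: real assume "e > 0"
    then obtain n where n: "1 / real (Suc n) < e" by (rule nat_approx_posE)
    obtain k where k: "G (Suc n) \<subseteq> B n k" using G(5) by blast
    have "S \<subseteq> B n k \<union> (S - G (Suc n))" using k by auto
    moreover have "closed (B n k \<union> (S - G (Suc n)))"
      using S unfolding B_def by (intro closed_Un closed_UN finite_imp_closed) auto
    ultimately have "closure S \<subseteq> B n k \<union> (S - G (Suc n))" by (rule closure_minimal)
    also have "\<dots> \<subseteq> (\<Union>x\<in>q ` {..k} \<union> (S - G (Suc n)). ball x e)"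
      using n \<open>e > 0\<close> unfolding B_def by force
    finally show "\<exists>k. finite k \<and> closure S \<subseteq> (\<Union>x\<in>k. ball x e)"
      using S by (intro exI[of _ "q ` {..k} \<union> (S - G (Suc n))"]) auto
  qed
  define K where "K = (\<Inter>n. G n)"
  have "closed K" unfolding K_def using G(1) by (intro closed_INT) auto
  have "finite (K - G n)" for n
  proof -
    have "K - G n = {}" unfolding K_def by auto
    then show ?thesis by (metis finite.emptyI)
  qed
  with compact_lim[of K] \<open>closed K\<close> have "compact K" by simp
  have sub: "(\<Inter>n. closure (p ` G n)) \<subseteq> p ` K"
  proof
    fix x assume x: "x \<in> (\<Inter>n. closure (p ` G n))"
    have "\<exists>u\<in>G n. dist (p u) x < 1 / real (Suc n)" for n
    proof -
      have "x \<in> closure (p ` G n)" using x by blast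
      then show ?thesis
        unfolding closure_approachable by force
    qed
    then obtain u where u: "\<And>n. u n \<in> G n" "\<And>n. dist (p (u n)) x < 1 / real (Suc n)" by metis
    have "finite (range u - G n)" for n
    proof (rule finite_subset)
      show "range u - G n \<subseteq> u ` {..n}"
      proof
        fix z assume "z \<in> range u - G n"
        then obtain k where "z = u k" "u k \<notin> G n" by blast
        moreover have "\<not> n \<le> k" using \<open>u k \<notin> G n\<close> u(1)[of k] decseqD[OF dec, of n k] by blast
        ultimately show "z \<in> u ` {..n}" by auto
      qed
    qed simp
    then have "compact (closure (range u))" by (rule compact_lim)
    then have "seq_compact (closure (range u))" by (simp add: compact_eq_seq_compact_metric)
    moreover have "\<forall>n. u n \<in> closure (range u)" using closure_subset by fastforce
    ultimately obtain l r where lr: "strict_mono r" "(u \<circ> r) \<longlonglongrightarrow> l"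
      unfolding seq_compact_def by metis
    have "l \<in> G n" for n
    proof (rule Lim_in_closed_set[OF G(1) _ _ lr(2)])
      have "(u \<circ> r) k \<in> G n" if "k \<ge> n" for k
        using u(1)[of "r k"] decseqD[OF dec, of n "r k"] seq_suble[OF lr(1), of k] that
        by (auto dest: order_trans)
      then show "\<forall>\<^sub>F k in sequentially. (u \<circ> r) k \<in> G n" by (auto simp: eventually_sequentially)
    qed simp
    then have "l \<in> K" by (simp add: K_def)
    have "(\<lambda>k. p ((u \<circ> r) k)) \<longlonglongrightarrow> p l"
      using continuous_on_tendsto_compose[OF p lr(2)] by simp
    moreover have "(\<lambda>n. p (u n)) \<longlonglongrightarrow> x"
    proof (rule metric_LIMSEQ_I)
      fix e :: real assume "e > 0"
      then obtain n where n: "1 / real (Suc n) < e" by (rule nat_approx_posE)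
      have "dist (p (u k)) x < e" if "k \<ge> n" for k
      proof -
        have "1 / real (Suc k) \<le> 1 / real (Suc n)" using that by (simp add: field_simps)
        with u(2)[of k] n show ?thesis by linarith
      qed
      then show "\<exists>no. \<forall>n\<ge>no. dist (p (u n)) x < e" by blast
    qed
    then have "(\<lambda>k. p ((u \<circ> r) k)) \<longlonglongrightarrow> x"
      using LIMSEQ_subseq_LIMSEQ[OF _ lr(1)] by (fastforce simp: o_def)
    ultimately have "x = p l" using LIMSEQ_unique by blast
    with \<open>l \<in> K\<close> show "x \<in> p ` K" by blast
  qed
  \<comment> \<open>Continuity from above needs measurable sets, so it is applied to the closures of
    the images; by \<open>sub\<close> their intersection is no larger than the image of
    \<open>K\<close>.\<close>
  have "c \<le> emeasure \<mu> (\<Inter>n. closure (p ` G n))"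
  proof (rule LIMSEQ_le_const)
    show "(\<lambda>n. emeasure \<mu> (closure (p ` G n))) \<longlonglongrightarrow> emeasure \<mu> (\<Inter>n. closure (p ` G n))"
      using G(4) by (intro Lim_emeasure_decseq decseq_SucI closure_mono image_mono) (auto simp: sets)
    have "c \<le> emeasure \<mu> (closure (p ` G n))" for n
    proof -
      have "c \<le> outer_measure_of \<mu> (p ` G n)" using G(3)[of n] by simp
      also have "\<dots> \<le> outer_measure_of \<mu> (closure (p ` G n))"
        by (intro outer_measure_of_mono closure_subset)
      also have "\<dots> = emeasure \<mu> (closure (p ` G n))" by (simp add: sets)
      finally show ?thesis .
    qed
    then show "\<exists>N. \<forall>n\<ge>N. c \<le> emeasure \<mu> (closure (p ` G n))" by blast
  qed
  also have "\<dots> \<le> emeasure \<mu> (p ` K)"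
  proof (rule emeasure_mono[OF sub])
    have "compact (p ` K)" using \<open>compact K\<close> p
      by (meson compact_continuous_image continuous_on_subset subset_UNIV)
    then show "p ` K \<in> sets \<mu>" by (simp add: sets compact_imp_closed)
  qed
  finally have "emeasure \<mu> (p ` K) > 0" using c(1) by (rule less_le_trans[rotated])
  moreover have "K \<subseteq> F" using G(2) by (auto simp: K_def)
  ultimately show thesis using \<open>compact K\<close> that by blast
qed

text \<open>If the image had positive outer measure, capacitability, applied to \<open>f\<close>
  after the projection from the closed set \<open>F\<close> above \<open>Z\<close>, would give a
  compact part of \<open>F\<close> with non-null image; its projection is a compact subset of
  \<open>Z\<close>. The conclusion is a null hull because the image itself need not be
  Borel.\<close>

lemma inner_null_imp_null_image:
  fixes \<mu> :: "'a::metric_space measure" and f :: "'b::polish_space \<Rightarrow> 'a"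
  assumes fin: "finite_measure \<mu>" and sets: "sets \<mu> = sets borel"
    and Z: "Z \<in> sets borel" and f: "continuous_on UNIV f"
    and null: "\<And>K. compact K \<Longrightarrow> K \<subseteq> Z \<Longrightarrow> emeasure \<mu> (f ` K) = 0"
  obtains P where "P \<in> null_sets \<mu>" "f ` Z \<subseteq> P"
proof -
  have sp: "space \<mu> = UNIV" using sets sets_eq_imp_space_eq by fastforce
  obtain F :: "('b \<times> (nat \<Rightarrow> nat discrete)) set" where F: "closed F" "Z = fst ` F"
    using borel_suslin[OF Z] unfolding suslin_def by blast
  have "outer_measure_of \<mu> (f ` Z) = 0"
  proof (rule ccontr)
    assume "outer_measure_of \<mu> (f ` Z) \<noteq> 0"
    then have pos: "outer_measure_of \<mu> ((f \<circ> fst) ` F) > 0"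
      unfolding F(2) image_comp by (simp add: zero_less_iff_neq_zero)
    have c: "continuous_on UNIV (f \<circ> fst :: 'b \<times> (nat \<Rightarrow> nat discrete) \<Rightarrow> 'a)"
      by (intro continuous_on_compose continuous_on_subset[OF f] continuous_intros) auto
    obtain K where K: "compact K" "K \<subseteq> F" "emeasure \<mu> ((f \<circ> fst) ` K) > 0"
      by (rule outer_image_compact[OF fin sets F(1) c pos])
    have "compact (fst ` K)" using K(1)
      by (intro compact_continuous_image continuous_intros)
    then have "emeasure \<mu> (f ` fst ` K) = 0" using K(2) F(2) by (intro null) auto
    with K(3) show False by (simp add: image_comp)
  qed
  moreover obtain P where "P \<in> sets \<mu>" "f ` Z \<subseteq> P" "outer_measure_of \<mu> (f ` Z) = emeasure \<mu> P"
    using outer_measure_of_attain[of "f ` Z" \<mu>] sp by blast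
  ultimately show thesis using that by (metis null_setsI)
qed


section \<open>Injectivity of countable-to-one maps on sets of positive measure\<close>

lemma compact_decseq_Inter:
  fixes K :: "nat \<Rightarrow> 'b::t2_space set"
  assumes "\<And>n. compact (K n)" "\<And>n. K n \<noteq> {}" "decseq K"
  shows "(\<Inter>n. K n) \<noteq> {}"
proof -
  have "K 0 \<inter> (\<Inter>n. K n) \<noteq> {}"
  proof (rule compact_imp_fip_image)
    show "compact (K 0)" "\<And>i. i \<in> UNIV \<Longrightarrow> closed (K i)"
      using assms(1) compact_imp_closed by auto
    fix I :: "nat set" assume I: "finite I"
    obtain n where n: "\<forall>i\<in>I. i \<le> n" using I finite_nat_set_iff_bounded_le by blast
    have "K n \<subseteq> K 0 \<inter> (\<Inter>i\<in>I. K i)"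
      using n assms(3) by (auto dest: decseqD)
    then show "K 0 \<inter> (\<Inter>i\<in>I. K i) \<noteq> {}" using assms(2)[of n] by blast
  qed
  then show ?thesis by blast
qed

lemma uncountable_nat_fun_bool: "uncountable (UNIV :: (nat \<Rightarrow> bool) set)"
proof
  assume "countable (UNIV :: (nat \<Rightarrow> bool) set)"
  then obtain g :: "(nat \<Rightarrow> bool) \<Rightarrow> nat" where g: "inj g" using countableE by blast
  have "g \<alpha> \<noteq> n" if "\<alpha> = (\<lambda>n. \<not> inv g n n)" for \<alpha> n
    using that g by (metis inv_f_f)
  then show False by blast
qed

text \<open>Equivalently, \<open>f\<^sub>*(\<tau>|E)\<close> has positive density with respect to \<open>f\<^sub>*\<tau>\<close> almost everywhere on \<open>D\<close>.\<close>

definition charges :: "'b::topological_space measure \<Rightarrow> ('b \<Rightarrow> 'c::topological_space) \<Rightarrow> 'b set \<Rightarrow> 'c set \<Rightarrow> bool" where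
  "charges \<tau> f E D \<longleftrightarrow>
     (\<forall>W\<in>sets borel. W \<subseteq> D \<longrightarrow> emeasure \<tau> (f -` W) > 0 \<longrightarrow> emeasure \<tau> (E \<inter> f -` W) > 0)"

lemma chargesD:
  "charges \<tau> f E D \<Longrightarrow> W \<in> sets borel \<Longrightarrow> W \<subseteq> D \<Longrightarrow> emeasure \<tau> (f -` W) > 0 \<Longrightarrow> emeasure \<tau> (E \<inter> f -` W) > 0"
  by (simp add: charges_def)

lemma charges_subset: "charges \<tau> f E D \<Longrightarrow> D' \<subseteq> D \<Longrightarrow> charges \<tau> f E D'"
  unfolding charges_def by auto

text \<open>Continuity of \<open>f\<close> is there to give compact sets compact images and to make
  fibres closed. The instances used are the two projections.\<close>

locale finite_borel_map =
  fixes \<tau> :: "'b::polish_space measure" and f :: "'b \<Rightarrow> 'c::polish_space"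
  assumes fin: "finite_measure \<tau>" and sets: "sets \<tau> = sets borel" and f: "continuous_on UNIV f"
begin

lemma space: "space \<tau> = UNIV"
  using sets sets_eq_imp_space_eq by fastforce

lemma measurable_f [measurable]: "f \<in> measurable \<tau> borel"
  using borel_measurable_continuous_onI[OF f] measurable_cong_sets[OF sets refl] by blast

lemma vimage_sets [simp]: "W \<in> sets borel \<Longrightarrow> f -` W \<in> sets borel"
  using measurable_sets[OF measurable_f, of W] by (simp add: space sets)

text \<open>\<open>D\<close> is where the Radon-Nikodym density \<open>h\<close> of the pushforward
  of \<tau> restricted to \<open>E\<close>, relative to the pushforward of \<tau>, is positive. Off
  \<open>D\<close> the integral of \<open>h\<close> vanishes; inside \<open>D\<close> it vanishes
  only over null sets.\<close>

lemma exists_charged_set: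
  assumes E: "E \<in> sets borel"
  obtains D where "D \<in> sets borel" "charges \<tau> f E D" "emeasure \<tau> (E \<inter> f -` (- D)) = 0"
proof -
  interpret finite_measure \<tau> by (rule fin)
  define \<nu> where "\<nu> = distr \<tau> borel f"
  define \<nu>' where "\<nu>' = distr (density \<tau> (indicator E)) borel f"
  interpret \<nu>: finite_measure \<nu> unfolding \<nu>_def by (rule finite_measure_distr) simp
  have [measurable]: "E \<in> sets \<tau>" using E by (simp add: sets)
  have em: "emeasure \<nu> W = emeasure \<tau> (f -` W)" if "W \<in> sets borel" for W
    unfolding \<nu>_def using that by (simp add: emeasure_distr space)
  have em': "emeasure \<nu>' W = emeasure \<tau> (E \<inter> f -` W)" if "W \<in> sets borel" for W
  proof -
    have "emeasure \<nu>' W = emeasure (density \<tau> (indicator E)) (f -` W)"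
      unfolding \<nu>'_def using that by (subst emeasure_distr) (auto simp: space)
    also have "\<dots> = (\<integral>\<^sup>+ x. indicator E x * indicator (f -` W) x \<partial>\<tau>)"
      using that by (subst emeasure_density) (auto simp: sets)
    also have "\<dots> = (\<integral>\<^sup>+ x. indicator (E \<inter> f -` W) x \<partial>\<tau>)"
      by (simp add: indicator_inter_arith)
    also have "\<dots> = emeasure \<tau> (E \<inter> f -` W)"
      using that E by (subst nn_integral_indicator) (auto simp: sets)
    finally show ?thesis .
  qed
  have s [simp]: "sets \<nu> = sets borel" "sets \<nu>' = sets borel" "space \<nu> = UNIV" by (auto simp: \<nu>_def \<nu>'_def)
  have ac: "absolutely_continuous \<nu> \<nu>'"
    unfolding absolutely_continuous_def
  proof
    fix W assume "W \<in> null_sets \<nu>"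
    then have W: "W \<in> sets borel" "emeasure \<tau> (f -` W) = 0"
      using em[of W] by (auto simp: null_sets_def)
    have "emeasure \<tau> (E \<inter> f -` W) \<le> emeasure \<tau> (f -` W)"
      using W E by (intro emeasure_mono) (auto simp: sets)
    then show "W \<in> null_sets \<nu>'" using W em' by (intro null_setsI) auto
  qed
  define h where "h = RN_deriv \<nu> \<nu>'"
  have h [measurable]: "h \<in> borel_measurable borel"
    unfolding h_def using borel_measurable_RN_deriv[of \<nu> \<nu>'] measurable_cong_sets[OF s(1) refl] by blast
  have dens: "emeasure \<nu>' W = (\<integral>\<^sup>+ x. h x * indicator W x \<partial>\<nu>)" if "W \<in> sets borel" for W
  proof -
    have "density \<nu> h = \<nu>'" unfolding h_def by (rule \<nu>.density_RN_deriv[OF ac]) simp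
    then have "emeasure \<nu>' W = emeasure (density \<nu> h) W" by simp
    also have "\<dots> = (\<integral>\<^sup>+ x. h x * indicator W x \<partial>\<nu>)"
      using that by (subst emeasure_density) (auto simp: h_def)
    finally show ?thesis .
  qed
  define D where "D = {x. h x > 0}"
  have D: "D \<in> sets borel" unfolding D_def by measurable
  show thesis
  proof
    show "D \<in> sets borel" by fact
    show "charges \<tau> f E D"
      unfolding charges_def
    proof (intro ballI impI)
      fix W :: "'c set" assume W: "W \<in> sets borel" "W \<subseteq> D" "0 < emeasure \<tau> (f -` W)"
      show "0 < emeasure \<tau> (E \<inter> f -` W)"
      proof (rule ccontr)
        assume "\<not> 0 < emeasure \<tau> (E \<inter> f -` W)"
        then have "(\<integral>\<^sup>+ x. h x * indicator W x \<partial>\<nu>) = 0"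
          using dens[OF W(1)] em'[OF W(1)] by simp
        moreover have "(\<lambda>x. h x * indicator W x) \<in> borel_measurable \<nu>"
          using W(1) unfolding h_def
          by (intro borel_measurable_times_ennreal borel_measurable_RN_deriv borel_measurable_indicator) simp
        ultimately have "emeasure \<nu> {x\<in>space \<nu>. h x * indicator W x \<noteq> 0} = 0"
          using nn_integral_0_iff by blast
        moreover have "{x\<in>space \<nu>. h x * indicator W x \<noteq> 0} = W"
          using W(2) by (auto simp: D_def indicator_def)
        ultimately show False using W(3) em[OF W(1)] by simp
      qed
    qed
    have "emeasure \<nu>' (- D) = (\<integral>\<^sup>+ x. 0 \<partial>\<nu>)"
      unfolding dens[OF borel_comp[OF D]]
      by (intro nn_integral_cong) (auto simp: D_def indicator_def)
    then show "emeasure \<tau> (E \<inter> f -` (- D)) = 0" using em'[OF borel_comp[OF D]] by simp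
  qed
qed

section \<open>Compact sets of positive measure and their splitting\<close>

lemma exists_compact_pos:
  assumes "E \<in> sets borel" "emeasure \<tau> E > 0"
  obtains K where "compact K" "K \<subseteq> E" "emeasure \<tau> K > 0"
proof -
  interpret finite_measure \<tau> by (rule fin)
  have "emeasure \<tau> E = (SUP K \<in> {K. K \<subseteq> E \<and> compact K}. emeasure \<tau> K)"
    using assms(1) by (intro inner_regular sets) auto
  then show thesis using assms(2) that by (auto simp: less_SUP_iff)
qed

lemma exists_compact_pos_vimage:
  assumes "D \<in> sets borel" "emeasure \<tau> (f -` D) > 0"
  obtains K where "compact K" "K \<subseteq> D" "emeasure \<tau> (f -` K) > 0"
proof -
  interpret finite_measure \<tau> by (rule fin)
  interpret \<nu>: finite_measure "distr \<tau> borel f" by (rule finite_measure_distr) simp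
  have em: "emeasure (distr \<tau> borel f) W = emeasure \<tau> (f -` W)" if "W \<in> sets borel" for W
    using that by (simp add: emeasure_distr space)
  have "emeasure (distr \<tau> borel f) D = (SUP K \<in> {K. K \<subseteq> D \<and> compact K}. emeasure (distr \<tau> borel f) K)"
    using assms(1) \<nu>.emeasure_finite by (intro inner_regular) auto
  then show thesis using assms that em compact_imp_closed
    by (fastforce simp: less_SUP_iff)
qed

text \<open>Shrinking \<open>E\<close> to a compact set may destroy charging, so the base shrinks
  too: to the part charged by \<open>c\<close>, cut with the image of \<open>c\<close>. Were the new
  base null, \<open>c\<close> would be covered by two null sets.\<close>

lemma charged_subset:
  assumes E: "E \<in> sets borel" and D: "D \<in> sets borel" "emeasure \<tau> (f -` D) > 0"
    and ch: "charges \<tau> f E D"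
  obtains c D' where "compact c" "c \<subseteq> E" "D' \<in> sets borel" "D' \<subseteq> D" "emeasure \<tau> (f -` D') > 0"
    "charges \<tau> f c D'" "D' \<subseteq> f ` c"
proof -
  have "emeasure \<tau> (E \<inter> f -` D) > 0" using chargesD[OF ch D(1)] D(2) by simp
  then obtain c where c: "compact c" "c \<subseteq> E \<inter> f -` D" "emeasure \<tau> c > 0"
    using exists_compact_pos[of "E \<inter> f -` D"] E D(1) by (metis sets.Int vimage_sets)
  have cb: "c \<in> sets borel" using c(1) by (simp add: compact_imp_closed)
  obtain D0 where D0: "D0 \<in> sets borel" "charges \<tau> f c D0" "emeasure \<tau> (c \<inter> f -` (- D0)) = 0"
    using exists_charged_set[OF cb] by blast
  have fc: "f ` c \<in> sets borel"
    using c(1) f by (meson borel_compact compact_continuous_image continuous_on_subset subset_UNIV)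
  define D' where "D' = D0 \<inter> D \<inter> f ` c"
  have D': "D' \<in> sets borel" unfolding D'_def using D0(1) D(1) fc by auto
  have "emeasure \<tau> (f -` D') > 0"
  proof (rule ccontr)
    assume "\<not> ?thesis"
    then have n: "f -` D' \<in> null_sets \<tau>" using D' by (intro null_setsI) (auto simp: sets)
    have "c \<inter> f -` (- D0) \<in> null_sets \<tau>" using D0 cb by (intro null_setsI) (auto simp: sets)
    with n have "f -` D' \<union> (c \<inter> f -` (- D0)) \<in> null_sets \<tau>" by (rule null_sets.Un)
    moreover have "c \<subseteq> f -` D' \<union> (c \<inter> f -` (- D0))" using c(2) unfolding D'_def by auto
    ultimately have "c \<in> null_sets \<tau>" using cb null_sets_subset by (metis sets)
    with c(3) show False by auto
  qed
  moreover have "charges \<tau> f c D'" using D0(2) by (rule charges_subset) (auto simp: D'_def)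
  ultimately show thesis using that[of c D'] c D' by (auto simp: D'_def)
qed

text \<open>If no two disjoint basic open sets charged a common part of \<open>D\<close> of positive
  measure, removing countably many null sets would make \<open>f\<close> injective on the rest of
  \<open>c\<close> above \<open>D\<close>, against \<open>noinj\<close>. Two such sets are then
  refined to compact pieces one after the other.\<close>

lemma split_charged:
  assumes noinj: "\<And>E. E \<in> sets borel \<Longrightarrow> E \<subseteq> C \<Longrightarrow> inj_on f E \<Longrightarrow> emeasure \<tau> E = 0"
    and c: "compact c" "c \<subseteq> C" and D: "D \<in> sets borel" "emeasure \<tau> (f -` D) > 0"
    and ch: "charges \<tau> f c D"
  obtains c0 c1 D' where "compact c0" "compact c1" "c0 \<subseteq> c" "c1 \<subseteq> c" "c0 \<inter> c1 = {}"
    "D' \<in> sets borel" "D' \<subseteq> D" "emeasure \<tau> (f -` D') > 0" "charges \<tau> f c0 D'" "charges \<tau> f c1 D'"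
    "D' \<subseteq> f ` c0" "D' \<subseteq> f ` c1"
proof -
  obtain \<B> :: "'b set set" where \<B>: "countable \<B>" "topological_basis \<B>"
    using ex_countable_basis by blast
  have cb: "c \<in> sets borel" using c(1) by (simp add: compact_imp_closed)
  define c' where "c' = c \<inter> f -` D"
  have c'b: "c' \<in> sets borel" unfolding c'_def using cb D by auto
  have c'pos: "emeasure \<tau> c' > 0" unfolding c'_def using chargesD[OF ch D(1)] D(2) by simp
  have opB: "U \<in> \<B> \<Longrightarrow> U \<in> sets borel" for U using \<B>(2) by (metis topological_basis_open borel_open)
  have "\<exists>DU. DU \<in> sets borel \<and> charges \<tau> f (c' \<inter> U) DU \<and> emeasure \<tau> (c' \<inter> U \<inter> f -` (- DU)) = 0"
    if "U \<in> \<B>" for U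
    using exists_charged_set[of "c' \<inter> U"] c'b opB[OF that] by (metis sets.Int)
  then obtain d where d: "\<And>U. U \<in> \<B> \<Longrightarrow> d U \<in> sets borel"
    "\<And>U. U \<in> \<B> \<Longrightarrow> charges \<tau> f (c' \<inter> U) (d U)"
    "\<And>U. U \<in> \<B> \<Longrightarrow> emeasure \<tau> (c' \<inter> U \<inter> f -` (- d U)) = 0" by metis
  have "\<exists>U\<in>\<B>. \<exists>V\<in>\<B>. U \<inter> V = {} \<and> emeasure \<tau> (f -` (D \<inter> d U \<inter> d V)) > 0"
  proof (rule ccontr)
    assume "\<not> ?thesis"
    then have neg: "emeasure \<tau> (f -` (D \<inter> d U \<inter> d V)) = 0" if "U \<in> \<B>" "V \<in> \<B>" "U \<inter> V = {}" for U V
      using that by (auto simp: not_gr_zero)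
    \<comment> \<open>Two points of \<open>c'\<close> outside \<open>Z\<close> in one fibre could be
      separated by basic \<open>U\<close> and \<open>V\<close>; the first part of \<open>Z\<close>
      forces their common value into \<open>d U\<close> and \<open>d V\<close>, which the second
      part excludes.\<close>
    define Z where "Z = (\<Union>U\<in>\<B>. c' \<inter> U \<inter> f -` (- d U)) \<union>
      (\<Union>(U, V)\<in>{(U, V). (U, V) \<in> \<B> \<times> \<B> \<and> U \<inter> V = {}}. f -` (D \<inter> d U \<inter> d V))"
    have cc: "countable {(U, V). (U, V) \<in> \<B> \<times> \<B> \<and> U \<inter> V = {}}"
      by (rule countable_subset[of _ "\<B> \<times> \<B>"]) (use \<B>(1) in auto)
    have "Z \<in> null_sets \<tau>"
      unfolding Z_def
      using \<B>(1) cc d(3) neg c'b opB d(1) D(1)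
      by (intro null_sets.Un null_sets_UN' null_setsI) (auto simp: sets intro!: sets.Int)
    moreover have "emeasure \<tau> (c' - Z) = 0"
    proof (rule noinj)
      show "c' - Z \<in> sets borel" using c'b \<open>Z \<in> null_sets \<tau>\<close> sets by auto
      show "c' - Z \<subseteq> C" using c by (auto simp: c'_def)
      show "inj_on f (c' - Z)"
      proof (rule inj_onI, rule ccontr)
        fix y y' assume y: "y \<in> c' - Z" "y' \<in> c' - Z" "f y = f y'" "y \<noteq> y'"
        obtain U V where "open U" "open V" "y \<in> U" "y' \<in> V" "U \<inter> V = {}"
          using hausdorff[OF y(4)] by blast
        moreover obtain U' where "U' \<in> \<B>" "y \<in> U'" "U' \<subseteq> U"
          using topological_basisE[OF \<B>(2) \<open>open U\<close> \<open>y \<in> U\<close>] by blast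
        moreover obtain V' where "V' \<in> \<B>" "y' \<in> V'" "V' \<subseteq> V"
          using topological_basisE[OF \<B>(2) \<open>open V\<close> \<open>y' \<in> V\<close>] by blast
        ultimately have UV: "U' \<in> \<B>" "V' \<in> \<B>" "y \<in> U'" "y' \<in> V'" "U' \<inter> V' = {}" by blast+
        have "f y \<in> d U'" using y(1) UV unfolding Z_def by blast
        moreover have "f y' \<in> d V'" using y(2) UV unfolding Z_def by blast
        moreover have "f y \<in> D" using y(1) by (simp add: c'_def)
        ultimately have "y \<in> f -` (D \<inter> d U' \<inter> d V')" using y(3) by simp
        then show False using y(1) UV unfolding Z_def by blast
      qed
    qed
    ultimately have "emeasure \<tau> (c' \<union> Z) = 0"
      using c'b by (metis Diff_partition Un_Diff_cancel2 emeasure_Un_null_set null_setsD2 sets sets.Diff)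
    moreover have "emeasure \<tau> c' \<le> emeasure \<tau> (c' \<union> Z)"
      using c'b \<open>Z \<in> null_sets \<tau>\<close> by (intro emeasure_mono) (auto simp: sets)
    ultimately show False using c'pos by simp
  qed
  then obtain U V where UV: "U \<in> \<B>" "V \<in> \<B>" "U \<inter> V = {}" "emeasure \<tau> (f -` (D \<inter> d U \<inter> d V)) > 0" by blast
  obtain c0 D0 where 0: "compact c0" "c0 \<subseteq> c' \<inter> U" "D0 \<in> sets borel" "D0 \<subseteq> D \<inter> d U \<inter> d V"
    "emeasure \<tau> (f -` D0) > 0" "charges \<tau> f c0 D0" "D0 \<subseteq> f ` c0"
  proof (rule charged_subset)
    show "c' \<inter> U \<in> sets borel" using c'b opB UV by auto
    show "D \<inter> d U \<inter> d V \<in> sets borel" using D d UV by auto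
    show "charges \<tau> f (c' \<inter> U) (D \<inter> d U \<inter> d V)" using d(2)[OF UV(1)] by (rule charges_subset) auto
  qed (use UV in auto)
  \<comment> \<open>The second refinement starts from the base \<open>D0\<close>: charging and
    covering pass down to \<open>D1\<close>, so the first piece keeps both.\<close>
  obtain c1 D1 where 1: "compact c1" "c1 \<subseteq> c' \<inter> V" "D1 \<in> sets borel" "D1 \<subseteq> D0"
    "emeasure \<tau> (f -` D1) > 0" "charges \<tau> f c1 D1" "D1 \<subseteq> f ` c1"
  proof (rule charged_subset)
    show "c' \<inter> V \<in> sets borel" using c'b opB UV by auto
    show "charges \<tau> f (c' \<inter> V) D0" using d(2)[OF UV(2)] by (rule charges_subset) (use 0 in auto)
  qed (use 0 in auto)
  show thesis
    using 0 1 UV(3) charges_subset[OF 0(6) 1(4)]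
    by (intro that[of c0 c1 D1]) (auto simp: c'_def)
qed

text \<open>All pieces of one level must be split over one base. They are treated one at a time
  while the base shrinks; charging and covering are inherited by smaller bases, so earlier
  splittings survive.\<close>

lemma split_charged_family:
  assumes noinj: "\<And>E. E \<in> sets borel \<Longrightarrow> E \<subseteq> C \<Longrightarrow> inj_on f E \<Longrightarrow> emeasure \<tau> E = 0"
    and I: "finite I" and D: "D \<in> sets borel" "emeasure \<tau> (f -` D) > 0"
    and c: "\<And>i. i \<in> I \<Longrightarrow> compact (c i) \<and> c i \<subseteq> C \<and> charges \<tau> f (c i) D"
  shows "\<exists>c' D'. D' \<in> sets borel \<and> D' \<subseteq> D \<and> emeasure \<tau> (f -` D') > 0 \<and>
     (\<forall>i\<in>I. c' i True \<inter> c' i False = {} \<and>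
        (\<forall>b. compact (c' i b) \<and> c' i b \<subseteq> c i \<and> charges \<tau> f (c' i b) D' \<and> D' \<subseteq> f ` c' i b))"
  using I c
proof (induction I)
  case empty
  then show ?case using D by auto
next
  case (insert i I)
  from insert.IH insert.prems obtain c' D' where D': "D' \<in> sets borel" "D' \<subseteq> D" "emeasure \<tau> (f -` D') > 0"
    and c': "\<forall>i\<in>I. c' i True \<inter> c' i False = {} \<and>
        (\<forall>b. compact (c' i b) \<and> c' i b \<subseteq> c i \<and> charges \<tau> f (c' i b) D' \<and> D' \<subseteq> f ` c' i b)"
    by (metis insertCI)
  have ci: "compact (c i)" "c i \<subseteq> C" "charges \<tau> f (c i) D'"
    using insert.prems[of i] charges_subset[OF _ D'(2)] by auto
  obtain c0 c1 D'' where *: "compact c0" "compact c1" "c0 \<subseteq> c i" "c1 \<subseteq> c i" "c0 \<inter> c1 = {}"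
    "D'' \<in> sets borel" "D'' \<subseteq> D'" "emeasure \<tau> (f -` D'') > 0" "charges \<tau> f c0 D''" "charges \<tau> f c1 D''"
    "D'' \<subseteq> f ` c0" "D'' \<subseteq> f ` c1"
    by (rule split_charged[OF noinj ci(1,2) D'(1,3) ci(3)])
  define e where "e = c'(i := (\<lambda>b. if b then c0 else c1))"
  have "e j True \<inter> e j False = {} \<and>
        (\<forall>b. compact (e j b) \<and> e j b \<subseteq> c j \<and> charges \<tau> f (e j b) D'' \<and> D'' \<subseteq> f ` e j b)"
    if "j \<in> insert i I" for j
  proof (cases "j = i")
    case True
    then show ?thesis using * by (simp add: e_def)
  next
    case False
    then have "j \<in> I" "e j = c' j" using that by (auto simp: e_def)
    then show ?thesis using c' *(7) by (metis charges_subset order_trans)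
  qed
  then show ?case using *(6-8) D'(2) by (intro exI[of _ e] exI[of _ D'']) auto
qed

text \<open>If \<open>f\<close> were injective on no subset of positive measure, one could split \<open>C\<close> along a Cantor
  scheme whose members all meet the fibre over a common point.\<close>

lemma exists_compact_inj_on:
  assumes C: "C \<in> sets borel" "emeasure \<tau> C > 0"
    and fibre: "\<And>x. countable {z \<in> C. f z = x}"
  obtains K where "compact K" "K \<subseteq> C" "emeasure \<tau> K > 0" "inj_on f K"
proof -
  have "\<exists>E\<in>sets borel. E \<subseteq> C \<and> inj_on f E \<and> emeasure \<tau> E > 0"
  proof (rule ccontr)
    assume "\<not> ?thesis"
    then have noinj: "\<And>E. E \<in> sets borel \<Longrightarrow> E \<subseteq> C \<Longrightarrow> inj_on f E \<Longrightarrow> emeasure \<tau> E = 0"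
      by (auto simp: not_gr_zero)
    \<comment> \<open>Covering the base keeps the fibres nonempty in the limit; charging is what
      allows the next split.\<close>
    define P where "P n p \<longleftrightarrow> (compact (snd p) \<and> emeasure \<tau> (f -` snd p) > 0 \<and>
       (\<forall>s. length s = n \<longrightarrow> compact (fst p s) \<and> fst p s \<subseteq> C \<and> charges \<tau> f (fst p s) (snd p) \<and> snd p \<subseteq> f ` fst p s))"
      for n :: nat and p :: "(bool list \<Rightarrow> 'b set) \<times> 'c set"
    define Q where "Q n p p' \<longleftrightarrow> snd p' \<subseteq> snd p \<and>
       (\<forall>s. length s = n \<longrightarrow> fst p' (True # s) \<inter> fst p' (False # s) = {} \<and> (\<forall>b. fst p' (b # s) \<subseteq> fst p s))"
      for n :: nat and p p' :: "(bool list \<Rightarrow> 'b set) \<times> 'c set"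
    have "\<exists>p. \<forall>n. P n (p n) \<and> Q n (p n) (p (Suc n))"
    proof (rule dependent_nat_choice)
      obtain D where D: "D \<in> sets borel" "charges \<tau> f C D" "emeasure \<tau> (C \<inter> f -` (- D)) = 0"
        using exists_charged_set[OF C(1)] by blast
      have "emeasure \<tau> (f -` D) > 0"
      proof (rule ccontr)
        assume "\<not> ?thesis"
        then have "f -` D \<union> (C \<inter> f -` (- D)) \<in> null_sets \<tau>"
          using D C by (intro null_sets.Un null_setsI) (auto simp: sets)
        then have "C \<in> null_sets \<tau>"
          by (rule null_sets_subset) (use C sets in auto)
        with C(2) show False by auto
      qed
      then obtain c D' where c: "compact c" "c \<subseteq> C" "D' \<in> sets borel" "emeasure \<tau> (f -` D') > 0"
        "charges \<tau> f c D'" "D' \<subseteq> f ` c"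
        using charged_subset[OF C(1) D(1) _ D(2)] by metis
      obtain K where K: "compact K" "K \<subseteq> D'" "emeasure \<tau> (f -` K) > 0"
        using exists_compact_pos_vimage[OF c(3,4)] by blast
      then show "\<exists>p. P 0 p"
        unfolding P_def using c charges_subset[OF c(5) K(2)]
        by (intro exI[of _ "(\<lambda>s. c, K)"]) auto
    next
      fix p n assume p: "P n p"
      define I where "I = {s :: bool list. length s = n}"
      have "finite I" unfolding I_def using finite_lists_length_eq[of "UNIV :: bool set" n] by simp
      moreover have "snd p \<in> sets borel" "emeasure \<tau> (f -` snd p) > 0"
        "\<And>s. s \<in> I \<Longrightarrow> compact (fst p s) \<and> fst p s \<subseteq> C \<and> charges \<tau> f (fst p s) (snd p)"
        using p by (auto simp: P_def I_def compact_imp_closed)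
      ultimately have "\<exists>c' D'. D' \<in> sets borel \<and> D' \<subseteq> snd p \<and> emeasure \<tau> (f -` D') > 0 \<and>
         (\<forall>i\<in>I. c' i True \<inter> c' i False = {} \<and>
            (\<forall>b. compact (c' i b) \<and> c' i b \<subseteq> fst p i \<and> charges \<tau> f (c' i b) D' \<and> D' \<subseteq> f ` c' i b))"
        by (intro split_charged_family[where C = C] noinj) auto
      then obtain c' D' where D': "D' \<in> sets borel" "D' \<subseteq> snd p" "emeasure \<tau> (f -` D') > 0"
        and c': "\<forall>i\<in>I. c' i True \<inter> c' i False = {} \<and>
        (\<forall>b. compact (c' i b) \<and> c' i b \<subseteq> fst p i \<and> charges \<tau> f (c' i b) D' \<and> D' \<subseteq> f ` c' i b)"
        by blast
      \<comment> \<open>Compact bases have a point common to all levels;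
        \<open>split_charged_family\<close> provides only a Borel base.\<close>
      obtain K where K: "compact K" "K \<subseteq> D'" "emeasure \<tau> (f -` K) > 0"
        using exists_compact_pos_vimage[OF D'(1,3)] by blast
      define p' where "p' = (\<lambda>s. c' (tl s) (hd s), K)"
      have "P (Suc n) p'"
        unfolding P_def
      proof (intro conjI allI impI)
        fix s :: "bool list" assume "length s = Suc n"
        then have s: "tl s \<in> I" by (simp add: I_def)
        then have cs: "compact (c' (tl s) (hd s))" "c' (tl s) (hd s) \<subseteq> fst p (tl s)"
          "charges \<tau> f (c' (tl s) (hd s)) D'" "D' \<subseteq> f ` c' (tl s) (hd s)" using c' by blast+
        show "compact (fst p' s)" using cs by (simp add: p'_def)
        have "fst p (tl s) \<subseteq> C" using p s by (simp add: P_def I_def)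
        then show "fst p' s \<subseteq> C" using cs by (simp add: p'_def)
        show "charges \<tau> f (fst p' s) (snd p')" using charges_subset[OF cs(3) K(2)] by (simp add: p'_def)
        show "snd p' \<subseteq> f ` fst p' s" using cs(4) K(2) by (simp add: p'_def)
      qed (use K in \<open>auto simp: p'_def\<close>)
      moreover have "Q n p p'"
        using c' K(2) D'(2) unfolding Q_def p'_def I_def by simp
      ultimately show "\<exists>p'. P (Suc n) p' \<and> Q n p p'" by blast
    qed
    then obtain p where p: "\<And>n. P n (p n)" "\<And>n. Q n (p n) (p (Suc n))" by blast
    have "(\<Inter>n. snd (p n)) \<noteq> {}"
    proof (rule compact_decseq_Inter)
      show "compact (snd (p n))" for n using p(1)[of n] by (simp add: P_def)
      show "snd (p n) \<noteq> {}" for n using p(1)[of n] by (auto simp: P_def)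
      show "decseq (\<lambda>n. snd (p n))" using p(2) by (intro decseq_SucI) (auto simp: Q_def)
    qed
    then obtain x where x: "\<And>n. x \<in> snd (p n)" by blast
    \<comment> \<open>Children are formed by consing, so the newest bit is at the head and the
      initial segment of \<alpha> appears reversed.\<close>
    define s where "s \<alpha> n = rev (map \<alpha> [0..<n])" for \<alpha> :: "nat \<Rightarrow> bool" and n
    have s: "length (s \<alpha> n) = n" "s \<alpha> (Suc n) = \<alpha> n # s \<alpha> n" for \<alpha> n by (auto simp: s_def)
    have "\<exists>z. \<forall>n. z \<in> fst (p n) (s \<alpha> n) \<and> f z = x" for \<alpha>
    proof -
      have "(\<Inter>n. fst (p n) (s \<alpha> n) \<inter> f -` {x}) \<noteq> {}"
      proof (rule compact_decseq_Inter)
        have "closed (f -` {x})" using f by (intro closed_vimage) auto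
        then show "compact (fst (p n) (s \<alpha> n) \<inter> f -` {x})" for n
          using p(1)[of n] s by (intro compact_Int_closed) (auto simp: P_def)
        show "fst (p n) (s \<alpha> n) \<inter> f -` {x} \<noteq> {}" for n
          using p(1)[of n] x[of n] s unfolding P_def by blast
        show "decseq (\<lambda>n. fst (p n) (s \<alpha> n) \<inter> f -` {x})"
        proof (rule decseq_SucI)
          fix n
          have "fst (p (Suc n)) (\<alpha> n # s \<alpha> n) \<subseteq> fst (p n) (s \<alpha> n)"
            using p(2)[of n] s unfolding Q_def by blast
          then show "fst (p (Suc n)) (s \<alpha> (Suc n)) \<inter> f -` {x} \<subseteq> fst (p n) (s \<alpha> n) \<inter> f -` {x}"
            unfolding s(2) by blast
        qed
      qed
      then show ?thesis by blast
    qed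
    then obtain z where z: "\<And>\<alpha> n. z \<alpha> \<in> fst (p n) (s \<alpha> n)" "\<And>\<alpha>. f (z \<alpha>) = x" by metis
    have "inj z"
    proof (rule injI, rule ccontr)
      fix \<alpha> \<beta> assume eq: "z \<alpha> = z \<beta>" and "\<alpha> \<noteq> \<beta>"
      then obtain k where k: "\<alpha> k \<noteq> \<beta> k" by auto
      \<comment> \<open>Up to the first difference both branches use the same word; the next bit
        sends them to disjoint children.\<close>
      define n where "n = (LEAST k. \<alpha> k \<noteq> \<beta> k)"
      have n: "\<alpha> n \<noteq> \<beta> n" unfolding n_def using k by (rule LeastI)
      have "\<alpha> i = \<beta> i" if "i < n" for i using that not_less_Least unfolding n_def by blast
      then have "s \<alpha> n = s \<beta> n" by (simp add: s_def)
      moreover have "z \<alpha> \<in> fst (p (Suc n)) (\<alpha> n # s \<alpha> n)" "z \<alpha> \<in> fst (p (Suc n)) (\<beta> n # s \<beta> n)"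
        using z(1)[of \<alpha> "Suc n"] z(1)[of \<beta> "Suc n"] eq by (simp_all add: s)
      moreover have "fst (p (Suc n)) (True # s \<alpha> n) \<inter> fst (p (Suc n)) (False # s \<alpha> n) = {}"
        using p(2)[of n] s unfolding Q_def by blast
      ultimately show False using n by (cases "\<alpha> n"; cases "\<beta> n") auto
    qed
    moreover have "range z \<subseteq> {z \<in> C. f z = x}"
    proof clarify
      fix \<alpha>
      have "z \<alpha> \<in> fst (p 0) (s \<alpha> 0)" by (rule z(1))
      moreover have "fst (p 0) (s \<alpha> 0) \<subseteq> C" using p(1)[of 0] s unfolding P_def by blast
      ultimately show "z \<alpha> \<in> C \<and> f (z \<alpha>) = x" using z(2) by blast
    qed
    ultimately have "countable (UNIV :: (nat \<Rightarrow> bool) set)"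
      using fibre[of x] countable_image_inj_on countable_subset by blast
    then show False using uncountable_nat_fun_bool by blast
  qed
  then obtain E where E: "E \<in> sets borel" "E \<subseteq> C" "inj_on f E" "emeasure \<tau> E > 0" by blast
  then obtain K where "compact K" "K \<subseteq> E" "emeasure \<tau> K > 0" using exists_compact_pos by blast
  then show thesis using E that by (meson inj_on_subset order_trans)
qed

end


section \<open>Null sets of a non-singular relation\<close>

locale measured_relation =
  fixes \<mu> :: "'a::polish_space measure" and R :: "('a \<times> 'a) set" and m :: "('a \<times> 'a) measure"
  assumes mu: "standard_prob_space \<mu>" and R: "countable_borel_equiv R"
    and nonsing: "nonsingular \<mu> R" and fin: "finite_measure m"
    and sets_eq: "sets m = sets (rel_measure \<mu> R)"
    and null_eq: "null_sets m = null_sets (rel_measure \<mu> R)"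
begin

sublocale finite_measure m by (rule fin)

lemma sets_mu: "sets \<mu> = sets borel"
  using mu by (simp add: standard_prob_space_def)

lemma R_borel: "R \<in> sets borel" and R_equiv: "equiv UNIV R" and R_countable: "countable (R `` {x})"
  using R by (auto simp: countable_borel_equiv_def)

lemma R_refl: "(x, x) \<in> R" and R_sym: "(x, y) \<in> R \<Longrightarrow> (y, x) \<in> R"
  and R_trans: "(x, y) \<in> R \<Longrightarrow> (y, z) \<in> R \<Longrightarrow> (x, z) \<in> R"
  using R_equiv by (auto simp: equiv_def refl_on_def dest: symD transD)

lemma sets_m: "sets m = {A \<in> sets borel. A \<subseteq> R}"
  using sets_eq sets_rel_measure[OF R_borel] by simp

lemma space_m: "space m = R"
  using sets.top[of m] sets.sets_into_space[of R m] R_borel unfolding sets_m by auto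

text \<open>\<open>m\<close> lives on the space \<open>R\<close>, whereas
  \<open>finite_borel_map\<close> wants a measure on all Borel sets of the product; \<tau> is
  \<open>m\<close> extended by zero.\<close>

definition \<tau> where "\<tau> = distr m borel (\<lambda>x. x)"

lemma measurable_id: "(\<lambda>x. x) \<in> measurable m borel"
  by (rule measurableI) (auto simp: space_m sets_m R_borel)

lemma emeasure_tau: "A \<in> sets m \<Longrightarrow> emeasure \<tau> A = emeasure m A"
  unfolding \<tau>_def by (subst emeasure_distr[OF measurable_id]) (auto simp: sets_m space_m Int_absorb2)

lemma finite_tau: "finite_measure \<tau>"
  unfolding \<tau>_def using measurable_id by (rule finite_measure_distr)

lemma exists_compact_inj_fst:
  assumes A: "A \<in> sets m" "emeasure m A > 0"
  obtains K where "compact K" "K \<subseteq> A" "emeasure m K > 0" "inj_on fst K"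
proof -
  interpret F: finite_borel_map \<tau> "fst :: 'a \<times> 'a \<Rightarrow> 'a"
    by (rule finite_borel_map.intro[OF finite_tau])
       (auto simp: \<tau>_def intro: continuous_on_fst continuous_on_snd continuous_on_id)
  have "countable {z \<in> A. fst z = x}" for x
  proof (rule countable_subset)
    show "{z \<in> A. fst z = x} \<subseteq> Pair x ` (R `` {x})" using A by (force simp: sets_m)
  qed (simp add: R_countable)
  then obtain K where "compact K" "K \<subseteq> A" "emeasure \<tau> K > 0" "inj_on fst K"
    using F.exists_compact_inj_on[of A] A by (auto simp: emeasure_tau sets_m)
  moreover have "K \<in> sets m" using calculation A by (auto simp: sets_m compact_imp_closed)
  ultimately show thesis using that by (simp add: emeasure_tau)
qed

lemma exists_compact_inj_snd:
  assumes A: "A \<in> sets m" "emeasure m A > 0"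
  obtains K where "compact K" "K \<subseteq> A" "emeasure m K > 0" "inj_on snd K"
proof -
  interpret F: finite_borel_map \<tau> "snd :: 'a \<times> 'a \<Rightarrow> 'a"
    by (rule finite_borel_map.intro[OF finite_tau])
       (auto simp: \<tau>_def intro: continuous_on_fst continuous_on_snd continuous_on_id)
  have "countable {z \<in> A. snd z = y}" for y
  proof (rule countable_subset)
    show "{z \<in> A. snd z = y} \<subseteq> (\<lambda>x. (x, y)) ` (R `` {y})" using A R_sym by (force simp: sets_m)
  qed (simp add: R_countable)
  then obtain K where "compact K" "K \<subseteq> A" "emeasure \<tau> K > 0" "inj_on snd K"
    using F.exists_compact_inj_on[of A] A by (auto simp: emeasure_tau sets_m)
  moreover have "K \<in> sets m" using calculation A by (auto simp: sets_m compact_imp_closed)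
  ultimately show thesis using that by (simp add: emeasure_tau)
qed

text \<open>The substitute for the Lusin--Novikov theorem.\<close>

lemma exists_graph_cover:
  "\<exists>K :: nat \<Rightarrow> ('a \<times> 'a) set.
     (\<forall>n. compact (K n) \<and> K n \<subseteq> R \<and> inj_on fst (K n)) \<and> R - (\<Union>n. K n) \<in> null_sets m"
proof -
  define V where "V = {K :: nat \<Rightarrow> ('a \<times> 'a) set. \<forall>n. compact (K n) \<and> K n \<subseteq> R \<and> inj_on fst (K n)}"
  have setsV: "K n \<in> sets m" if "K \<in> V" for K n
    using that by (auto simp: V_def sets_m compact_imp_closed)
  define val where "val K = measure m (\<Union>n. K n)" for K :: "nat \<Rightarrow> ('a \<times> 'a) set"
  define s where "s = (SUP K\<in>V. val K)"
  have "(\<lambda>_. {}) \<in> V" by (simp add: V_def)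
  have bdd: "bdd_above (val ` V)"
    by (rule bdd_aboveI[of _ "measure m (space m)"]) (auto simp: val_def intro: bounded_measure)
  have "\<exists>K\<in>V. s - 1 / real (Suc k) < val K" for k
    unfolding s_def using \<open>(\<lambda>_. {}) \<in> V\<close> bdd
    by (intro less_cSUP_iff[THEN iffD1]) auto
  then obtain L where L: "\<And>k. L k \<in> V" "\<And>k. s - 1 / real (Suc k) < val (L k)" by metis
  \<comment> \<open>Interleaving the near-optimal families gives one whose union contains all
    theirs, so the supremum is attained.\<close>
  define K where "K n = L (fst (prod_decode n)) (snd (prod_decode n))" for n
  have "K \<in> V" using L(1) unfolding V_def K_def by auto
  have "val (L k) \<le> val K" for k
    unfolding val_def
  proof (rule finite_measure_mono)
    show "(\<Union>n. L k n) \<subseteq> (\<Union>n. K n)"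
    proof clarify
      fix x n assume "x \<in> L k n"
      then have "x \<in> K (prod_encode (k, n))" by (simp add: K_def)
      then show "x \<in> (\<Union>n. K n)" by blast
    qed
  qed (use setsV[OF \<open>K \<in> V\<close>] in auto)
  then have lt: "s - 1 / real (Suc k) < val K" for k using L(2)[of k] by (meson less_le_trans)
  have "s \<le> val K"
  proof (rule field_le_epsilon)
    fix e :: real assume "e > 0"
    then obtain k where "1 / real (Suc k) < e" by (rule nat_approx_posE)
    then show "s \<le> val K + e" using lt[of k] by linarith
  qed
  have UK: "(\<Union>n. K n) \<in> sets m" using setsV[OF \<open>K \<in> V\<close>] by auto
  have RU: "R - (\<Union>n. K n) \<in> sets m" using UK space_m sets.compl_sets by metis
  have "emeasure m (R - (\<Union>n. K n)) = 0"
  proof (rule ccontr)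
    assume "\<not> ?thesis"
    then obtain C where C: "compact C" "C \<subseteq> R - (\<Union>n. K n)" "emeasure m C > 0" "inj_on fst C"
      using exists_compact_inj_fst[OF RU] by (metis not_gr_zero)
    have Cs: "C \<in> sets m" using C by (auto simp: sets_m compact_imp_closed)
    have "case_nat C K \<in> V" using C \<open>K \<in> V\<close> by (auto simp: V_def split: nat.split)
    then have "val (case_nat C K) \<le> s" unfolding s_def using bdd by (intro cSUP_upper)
    moreover have "(\<Union>n. case_nat C K n) = C \<union> (\<Union>n. K n)"
      by (subst UNIV_nat_eq) simp
    then have "val (case_nat C K) = measure m C + val K"
      unfolding val_def using UK Cs C(2) by (subst finite_measure_Union[symmetric]) auto
    moreover have "measure m C > 0" using C(3) by (simp add: emeasure_eq_measure)
    ultimately show False using \<open>s \<le> val K\<close> by linarith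
  qed
  then show ?thesis using \<open>K \<in> V\<close> RU by (intro exI[of _ K]) (auto simp: V_def)
qed

text \<open>If the formula for \<open>M\<close> failed to be countably additive, \<open>measure_of\<close> would return the zero measure.
  This case split avoids proving that \<open>x \<mapsto> |A\<^sub>x|\<close> is measurable.\<close>

lemma rel_measure_cases:
  obtains (zero) "\<And>A. A \<in> sets m \<Longrightarrow> A \<in> null_sets m"
  | (formula) "\<And>A. A \<in> sets m \<Longrightarrow>
      emeasure (rel_measure \<mu> R) A = (\<integral>\<^sup>+ x. emeasure (count_space UNIV) (A `` {x}) \<partial>\<mu>)"
proof -
  let ?l = "\<lambda>A. \<integral>\<^sup>+ x. emeasure (count_space UNIV) (A `` {x}) \<partial>\<mu>"
  have sig: "sigma_sets R (sets m) = sets m" using sets.sigma_sets_eq[of m] by (simp add: space_m)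
  have N: "rel_measure \<mu> R = measure_of R (sets m) ?l" by (simp add: rel_measure_def sets_m)
  have em: "emeasure (rel_measure \<mu> R) A = (if A \<in> sets m \<and> measure_space R (sets m) ?l then ?l A else 0)" for A
    unfolding N emeasure_measure_of_conv sig ..
  show thesis
  proof (cases "measure_space R (sets m) ?l")
    case True
    then show thesis using em by (intro formula) simp
  next
    case False
    then show thesis using em sets_eq by (intro zero) (auto simp: null_eq)
  qed
qed

lemma converse_sets: "Z \<in> sets m \<Longrightarrow> converse Z \<in> sets m"
proof -
  assume Z: "Z \<in> sets m"
  have "prod.swap -` Z \<inter> space borel \<in> sets borel"
    using Z by (intro measurable_sets[of _ borel borel] borel_measurable_continuous_onI continuous_on_swap)
       (auto simp: sets_m)
  moreover have "prod.swap -` Z \<inter> space borel = converse Z" by auto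
  ultimately show ?thesis using Z R_sym by (auto simp: sets_m)
qed

lemma Times_UNIV_sets: "P \<in> sets borel \<Longrightarrow> R \<inter> (P \<times> UNIV) \<in> sets m"
  using R_borel borel_Times[of P UNIV] by (auto simp: sets_m)

section \<open>Null sets of the relation and null sets of its domain\<close>

context
  assumes formula: "\<And>A. A \<in> sets m \<Longrightarrow>
      emeasure (rel_measure \<mu> R) A = (\<integral>\<^sup>+ x. emeasure (count_space UNIV) (A `` {x}) \<partial>\<mu>)"
begin

text \<open>Over each point of \<open>B\<close> there is at least one point of \<open>Z\<close>, so
  the formula bounds the measure of \<open>B\<close>. Borel subsets \<open>B\<close> are used
  because the projection of \<open>Z\<close> need not be Borel.\<close>

lemma null_imp_null_domain:
  assumes Z: "Z \<in> null_sets m" and B: "B \<in> sets borel" "B \<subseteq> fst ` Z"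
  shows "emeasure \<mu> B = 0"
proof -
  have "emeasure \<mu> B = (\<integral>\<^sup>+ x. indicator B x \<partial>\<mu>)" using B sets_mu by simp
  also have "\<dots> \<le> (\<integral>\<^sup>+ x. emeasure (count_space UNIV) (Z `` {x}) \<partial>\<mu>)"
  proof (rule nn_integral_mono)
    fix x
    show "indicator B x \<le> emeasure (count_space UNIV) (Z `` {x})"
    proof (cases "x \<in> B")
      case True
      then obtain y where "(x, y) \<in> Z" using B(2) by force
      then have "emeasure (count_space UNIV) {y} \<le> emeasure (count_space UNIV) (Z `` {x})"
        by (intro emeasure_mono) auto
      then show ?thesis using True by simp
    qed simp
  qed
  also have "\<dots> = emeasure (rel_measure \<mu> R) Z" using formula Z by auto
  also have "\<dots> = 0" using Z by (auto simp: null_eq)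
  finally show ?thesis by simp
qed

lemma null_domain_imp_null:
  assumes Z: "Z \<in> sets m" and P: "P \<in> null_sets \<mu>" "fst ` Z \<subseteq> P"
  shows "Z \<in> null_sets m"
proof -
  have "emeasure (rel_measure \<mu> R) Z = (\<integral>\<^sup>+ x. emeasure (count_space UNIV) (Z `` {x}) \<partial>\<mu>)"
    using Z by (rule formula)
  \<comment> \<open>Fibres over \<open>P\<close> may be infinite; the bound still integrates to zero
    because \<infinity> times zero is zero in \<open>ennreal\<close>.\<close>
  also have "\<dots> \<le> (\<integral>\<^sup>+ x. \<infinity> * indicator P x \<partial>\<mu>)"
  proof (rule nn_integral_mono)
    fix x
    show "emeasure (count_space UNIV) (Z `` {x}) \<le> \<infinity> * indicator P x"
    proof (cases "x \<in> P")
      case False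
      then have "Z `` {x} = {}" using P(2) by force
      then show ?thesis by simp
    qed simp
  qed
  also have "\<dots> = 0" using P(1) by (subst nn_integral_cmult_indicator) auto
  finally show ?thesis using Z sets_eq unfolding null_eq by (intro null_setsI) auto
qed

text \<open>The use of non-singularity. A converse of positive measure contains a compact set on
  which both projections are injective, that is, the graph of a Borel bijection inside
  \<open>R\<close>. Its range lies in the domain of \<open>Z\<close> and so is null; hence its
  domain is null, and with it the graph.\<close>

lemma converse_null_formula:
  assumes Z: "Z \<in> null_sets m"
  shows "converse Z \<in> null_sets m"
proof (rule ccontr)
  have Zs: "converse Z \<in> sets m" using Z by (intro converse_sets) auto
  assume "converse Z \<notin> null_sets m"
  then have "emeasure m (converse Z) > 0" using Zs by (auto simp: zero_less_iff_neq_zero)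
  then obtain K1 where K1: "compact K1" "K1 \<subseteq> converse Z" "emeasure m K1 > 0" "inj_on fst K1"
    using exists_compact_inj_fst[OF Zs] by blast
  have "K1 \<in> sets m" using K1 Zs by (auto simp: sets_m compact_imp_closed)
  then obtain K where K: "compact K" "K \<subseteq> K1" "emeasure m K > 0" "inj_on snd K"
    using exists_compact_inj_snd K1(3) by blast
  have inj: "inj_on fst K" using K1(4) K(2) by (rule inj_on_subset)
  have Ks: "K \<in> sets m" using K K1 Zs by (auto simp: sets_m compact_imp_closed)
  have comp: "compact (fst ` K)" "compact (snd ` K)"
    using K(1) by (auto intro!: compact_continuous_image continuous_on_fst continuous_on_snd continuous_on_id)
  then have bor: "fst ` K \<in> sets borel" "snd ` K \<in> sets borel" by (auto simp: compact_imp_closed)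
  define g where "g = inv_into K fst"
  have g: "g (fst z) = z" if "z \<in> K" for z unfolding g_def using inj that by simp
  have "continuous_on (fst ` K) g"
    by (rule continuous_on_inv[OF _ K(1)]) (auto simp: g intro: continuous_on_fst continuous_on_id)
  then have "continuous_on (fst ` K) (\<lambda>x. snd (g x))" by (rule continuous_on_snd)
  then have "(\<lambda>x. snd (g x)) \<in> measurable (restrict_space borel (fst ` K)) borel"
    by (rule borel_measurable_continuous_on_restrict)
  moreover have "bij_betw (\<lambda>x. snd (g x)) (fst ` K) (snd ` K)"
    unfolding bij_betw_def using K(4) g by (force simp: inj_on_def image_image)
  moreover have "\<forall>x\<in>fst ` K. (x, snd (g x)) \<in> R" using Ks g by (auto simp: sets_m)
  ultimately have "emeasure \<mu> (fst ` K) = 0 \<longleftrightarrow> emeasure \<mu> (snd ` K) = 0"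
    using nonsing bor unfolding nonsingular_def by blast
  moreover have "emeasure \<mu> (snd ` K) = 0"
    using K(2) K1(2) by (intro null_imp_null_domain[OF Z bor(2)]) force
  ultimately have "fst ` K \<in> null_sets \<mu>" using bor sets_mu by auto
  then have "K \<in> null_sets m" using null_domain_imp_null[OF Ks] by blast
  then show False using K(3) by auto
qed

lemma null_imp_domain_subset_null:
  assumes Z: "Z \<in> null_sets m"
  obtains P where "P \<in> null_sets \<mu>" "fst ` Z \<subseteq> P"
proof (rule inner_null_imp_null_image[of \<mu> Z fst])
  show "finite_measure \<mu>" using mu by (auto simp: standard_prob_space_def intro: prob_space.finite_measure)
  show "sets \<mu> = sets borel" by (rule sets_mu)
  show "Z \<in> sets borel" using Z null_setsD2[OF Z] by (auto simp: sets_m)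
  show "continuous_on UNIV (fst :: 'a \<times> 'a \<Rightarrow> 'a)" by (intro continuous_on_fst continuous_on_id)
  fix K assume K: "compact K" "K \<subseteq> Z"
  have "compact (fst ` K)"
    using K(1) by (intro compact_continuous_image continuous_on_fst continuous_on_id)
  then show "emeasure \<mu> (fst ` K) = 0"
    using K(2) by (intro null_imp_null_domain[OF Z]) (auto simp: compact_imp_closed)
qed (use that in auto)

text \<open>The saturation of a null set \<open>P\<close> is the domain of the converse of the part
  of \<open>R\<close> over \<open>P\<close>, so it has a null hull. As hulls need not be invariant,
  the step is repeated and the union of the hulls taken.\<close>

lemma null_invariant_domain_formula:
  assumes Z: "Z \<in> null_sets m"
  shows "\<exists>P\<in>sets borel. R `` P \<subseteq> P \<and> fst ` Z \<subseteq> P \<and> R \<inter> (P \<times> UNIV) \<in> null_sets m"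
proof -
  obtain P0 where P0: "P0 \<in> null_sets \<mu>" "fst ` Z \<subseteq> P0" using null_imp_domain_subset_null[OF Z] by blast
  have "\<exists>P. \<forall>n. (P n \<in> null_sets \<mu> \<and> fst ` Z \<subseteq> P n) \<and> R `` P n \<subseteq> P (Suc n)"
  proof (rule dependent_nat_choice)
    show "\<exists>P. P \<in> null_sets \<mu> \<and> fst ` Z \<subseteq> P" using P0 by blast
  next
    fix P and n :: nat assume P: "P \<in> null_sets \<mu> \<and> fst ` Z \<subseteq> P"
    then have "R \<inter> (P \<times> UNIV) \<in> sets m" using sets_mu null_setsD2 by (intro Times_UNIV_sets) blast
    then have "R \<inter> (P \<times> UNIV) \<in> null_sets m" using P by (intro null_domain_imp_null) auto
    then have "converse (R \<inter> (P \<times> UNIV)) \<in> null_sets m" by (rule converse_null_formula)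
    then obtain P' where P': "P' \<in> null_sets \<mu>" "fst ` converse (R \<inter> (P \<times> UNIV)) \<subseteq> P'"
      using null_imp_domain_subset_null by blast
    have "R `` P \<subseteq> P'" using P'(2) by force
    have "P \<subseteq> R `` P" using R_refl by blast
    with P \<open>R `` P \<subseteq> P'\<close> have "fst ` Z \<subseteq> P'" by (meson order_trans)
    with \<open>R `` P \<subseteq> P'\<close> show "\<exists>P'. (P' \<in> null_sets \<mu> \<and> fst ` Z \<subseteq> P') \<and> R `` P \<subseteq> P'"
      using P'(1) by (intro exI[of _ P']) simp
  qed
  then obtain P where "\<forall>n. (P n \<in> null_sets \<mu> \<and> fst ` Z \<subseteq> P n) \<and> R `` P n \<subseteq> P (Suc n)" by (rule exE)
  then have P: "P n \<in> null_sets \<mu>" "fst ` Z \<subseteq> P n" "R `` P n \<subseteq> P (Suc n)" for n by simp_all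
  have null: "(\<Union>n. P n) \<in> null_sets \<mu>" using P(1) by (rule null_sets_UN)
  then have b: "(\<Union>n. P n) \<in> sets borel" using sets_mu null_setsD2 by blast
  show ?thesis
  proof (intro bexI conjI)
    show "R \<inter> ((\<Union>n. P n) \<times> UNIV) \<in> null_sets m"
      using null by (intro null_domain_imp_null[OF Times_UNIV_sets[OF b]]) auto
    show "R `` (\<Union>n. P n) \<subseteq> (\<Union>n. P n)" using P(3) by blast
    show "fst ` Z \<subseteq> (\<Union>n. P n)" using P(2) by blast
  qed (rule b)
qed

end

lemma null_invariant_domain:
  assumes Z: "Z \<in> null_sets m"
  obtains P where "P \<in> sets borel" "R `` P \<subseteq> P" "fst ` Z \<subseteq> P" "R \<inter> (P \<times> UNIV) \<in> null_sets m"
proof (cases rule: rel_measure_cases)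
  case zero
  \<comment> \<open>If every set in \<open>sets m\<close> is null, the whole space serves as
    exceptional set.\<close>
  then show thesis using that[of UNIV] Times_UNIV_sets[of UNIV] by auto
next
  case formula
  then show thesis using null_invariant_domain_formula[OF _ Z] that by blast
qed

end


section \<open>Generated equivalence relations\<close>

lemma generated_equiv_eq_rtrancl: "generated_equiv A = (A \<union> converse A)\<^sup>*"
proof
  have "sym ((A \<union> converse A)\<^sup>*)" by (intro sym_rtrancl symI) auto
  then have "equiv UNIV ((A \<union> converse A)\<^sup>*)"
    by (intro equivI) (auto simp: refl_on_def trans_rtrancl)
  then show "generated_equiv A \<subseteq> (A \<union> converse A)\<^sup>*"
    unfolding generated_equiv_def by blast
  show "(A \<union> converse A)\<^sup>* \<subseteq> generated_equiv A"
    unfolding generated_equiv_def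
  proof (rule Inter_greatest)
    fix S assume "S \<in> {S. equiv UNIV S \<and> A \<subseteq> S}"
    then have S: "refl S" "sym S" "trans S" "A \<union> converse A \<subseteq> S"
      by (auto simp: equiv_def dest: symD)
    show "(A \<union> converse A)\<^sup>* \<subseteq> S"
    proof clarify
      fix x y assume "(x, y) \<in> (A \<union> converse A)\<^sup>*"
      then show "(x, y) \<in> S"
      proof (induction rule: rtrancl_induct)
        case base
        show ?case using S(1) by (simp add: refl_on_def)
      next
        case (step y z)
        then show ?case using S(3,4) by (meson subsetD transD)
      qed
    qed
  qed
qed

text \<open>The factor \<open>E\<close> is covered by graphs of continuous functions, which makes relational composition a
  countable union of preimages; in general it is only a projection.\<close>

lemma relcomp_borel:
  fixes K :: "nat \<Rightarrow> ('a::polish_space \<times> 'b::polish_space) set" and C :: "('b \<times> 'c::polish_space) set"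
  assumes K: "\<And>n. compact (K n)" "\<And>n. inj_on fst (K n)"
    and E: "E \<in> sets borel" "E \<subseteq> (\<Union>n. K n)" and C: "C \<in> sets borel"
  shows "E O C \<in> sets borel"
proof -
  define g where "g n = inv_into (K n) fst" for n
  have g: "g n (fst z) = z" if "z \<in> K n" for n z unfolding g_def using K(2) that by simp
  define D where "D n = fst ` K n \<times> (UNIV :: 'c set)" for n
  \<comment> \<open>On the domain of the graph \<open>K n\<close> the middle point is determined:
    \<open>h n\<close> sends \<open>(x, z)\<close> to \<open>((x, y), (y, z))\<close> with
    \<open>(x, y)\<close> in \<open>K n\<close>. Off \<open>D n\<close> the value of
    \<open>inv_into\<close> is arbitrary, hence the restriction.\<close>
  define h where "h n w = (g n (fst w), (snd (g n (fst w)), snd w))" for n and w :: "'a \<times> 'c"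
  have D: "D n \<in> sets borel" for n
  proof -
    have "compact (fst ` K n)"
      using K(1) by (intro compact_continuous_image continuous_on_fst continuous_on_id)
    then have "closed (D n)" unfolding D_def by (intro closed_Times compact_imp_closed closed_UNIV)
    then show ?thesis by simp
  qed
  have "E O C = (\<Union>n. h n -` (E \<times> C) \<inter> D n)"
  proof (intro equalityI subsetI)
    fix w assume "w \<in> E O C"
    then obtain x y z where w: "w = (x, z)" "(x, y) \<in> E" "(y, z) \<in> C" by auto
    then obtain n where n: "(x, y) \<in> K n" using E(2) by blast
    then have "g n x = (x, y)" using g[OF n] by simp
    then have "w \<in> h n -` (E \<times> C) \<inter> D n" using w n by (force simp: h_def D_def)
    then show "w \<in> (\<Union>n. h n -` (E \<times> C) \<inter> D n)" by blast
  next
    fix w assume "w \<in> (\<Union>n. h n -` (E \<times> C) \<inter> D n)"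
    then obtain n where "w \<in> h n -` (E \<times> C) \<inter> D n" by (rule UN_E)
    then have n: "h n w \<in> E \<times> C" "w \<in> D n" by simp_all
    then obtain y where "(fst w, y) \<in> K n" unfolding D_def by force
    from g[OF this] n(1) show "w \<in> E O C" by (cases w) (auto simp: h_def)
  qed
  moreover have "h n -` (E \<times> C) \<inter> D n \<in> sets borel" for n
  proof -
    have "continuous_on (fst ` K n) (g n)"
      by (rule continuous_on_inv[OF _ K(1)]) (auto simp: g intro: continuous_on_fst continuous_on_id)
    then have gc: "continuous_on (D n) (\<lambda>w. g n (fst w))"
      by (rule continuous_on_compose2) (auto simp: D_def intro: continuous_on_fst continuous_on_id)
    have "continuous_on (D n) (h n)"
      unfolding h_def by (intro continuous_on_Pair continuous_on_snd gc continuous_on_id)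
    then have "h n \<in> measurable (restrict_space borel (D n)) borel"
      by (rule borel_measurable_continuous_on_restrict)
    moreover have "E \<times> C \<in> sets borel" using E(1) C by (rule borel_Times)
    ultimately have "h n -` (E \<times> C) \<inter> D n \<in> sets (restrict_space borel (D n))"
      using measurable_sets[of "h n" "restrict_space borel (D n)" borel "E \<times> C"]
      by (simp add: space_restrict_space)
    then show ?thesis using D by (auto simp: sets_restrict_space_iff)
  qed
  ultimately show ?thesis by auto
qed

section \<open>Generation up to invariant null sets\<close>

context measured_relation
begin

lemma invariant_iff: "R `` P \<subseteq> P \<Longrightarrow> (x, y) \<in> R \<Longrightarrow> x \<in> P \<longleftrightarrow> y \<in> P"
  using R_sym by blast

lemma generated_equiv_subset: "A \<subseteq> R \<Longrightarrow> generated_equiv A \<subseteq> R"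
  using R_equiv unfolding generated_equiv_def by blast

lemma eventually_generated_equiv:
  assumes A: "A \<subseteq> R" and P: "R `` P \<subseteq> P"
    and ev: "\<And>x y. (x, y) \<in> A \<Longrightarrow> x \<notin> P \<Longrightarrow> eventually (\<lambda>n. (x, y) \<in> B n) F"
    and xy: "(x, y) \<in> generated_equiv A" "x \<notin> P"
  shows "eventually (\<lambda>n. (x, y) \<in> generated_equiv (B n)) F"
  using xy(1) unfolding generated_equiv_eq_rtrancl
proof (induction rule: rtrancl_induct)
  case base
  then show ?case by simp
next
  case (step y z)
  have "(x, y) \<in> R"
    using generated_equiv_subset[OF A] step.hyps(1) by (auto simp: generated_equiv_eq_rtrancl)
  then have y: "y \<notin> P" using invariant_iff[OF P] xy(2) by blast
  have "eventually (\<lambda>n. (y, z) \<in> B n \<union> converse (B n)) F"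
  proof (cases "(y, z) \<in> A")
    case True
    then show ?thesis using ev[OF True y] by (auto elim: eventually_mono)
  next
    case False
    then have zy: "(z, y) \<in> A" using step.hyps(2) by auto
    \<comment> \<open>A reversed edge is controlled from its source \<open>z\<close>, which
      invariance keeps outside \<open>P\<close>.\<close>
    then have "z \<notin> P" using invariant_iff[OF P, of z y] A y by blast
    from ev[OF zy this] show ?thesis by (auto elim: eventually_mono)
  qed
  with step.IH show ?case
    by eventually_elim (rule rtrancl_into_rtrancl)
qed

text \<open>An almost-everywhere statement about pairs cannot be followed along a path, whose next
  edge might be exceptional. Off an invariant set it holds at every edge.\<close>

lemma AE_imp_off_invariant_null:
  assumes "AE p in m. Q p"
  obtains P where "P \<in> sets borel" "R `` P \<subseteq> P" "R \<inter> (P \<times> UNIV) \<in> null_sets m"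
    "\<And>x y. (x, y) \<in> R \<Longrightarrow> x \<notin> P \<Longrightarrow> Q (x, y)"
proof -
  obtain Z where Z: "Z \<in> null_sets m" "{p \<in> space m. \<not> Q p} \<subseteq> Z"
    using assms unfolding eventually_ae_filter by blast
  obtain P where P: "P \<in> sets borel" "R `` P \<subseteq> P" "fst ` Z \<subseteq> P" "R \<inter> (P \<times> UNIV) \<in> null_sets m"
    using null_invariant_domain[OF Z(1)] by blast
  have "Q (x, y)" if "(x, y) \<in> R" "x \<notin> P" for x y
    using that Z(2) P(3) by (force simp: space_m)
  with P show thesis using that by blast
qed

lemma AE_eventually_generated_equiv:
  assumes A: "A \<in> sets m" and ev: "AE p in m. p \<in> A \<longrightarrow> eventually (\<lambda>n. p \<in> B n) F"
  shows "AE p in m. p \<in> generated_equiv A \<longrightarrow> eventually (\<lambda>n. p \<in> generated_equiv (B n)) F"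
proof -
  have AR: "A \<subseteq> R" using A by (simp add: sets_m)
  obtain P where P: "R `` P \<subseteq> P" "R \<inter> (P \<times> UNIV) \<in> null_sets m"
    "\<And>x y. (x, y) \<in> R \<Longrightarrow> x \<notin> P \<Longrightarrow> (x, y) \<in> A \<longrightarrow> eventually (\<lambda>n. (x, y) \<in> B n) F"
    using AE_imp_off_invariant_null[OF ev] by metis
  have "eventually (\<lambda>n. (x, y) \<in> generated_equiv (B n)) F" if "(x, y) \<in> generated_equiv A" "x \<notin> P" for x y
    using AR P(3) by (intro eventually_generated_equiv[OF AR P(1) _ that]) auto
  then show ?thesis using P(2) by (intro AE_I'[of "R \<inter> (P \<times> UNIV)"]) (auto simp: space_m)
qed

lemma AE_generated_equiv_cong:
  assumes "A \<in> sets m" "B \<in> sets m" "AE p in m. p \<in> A \<longleftrightarrow> p \<in> B"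
  shows "AE p in m. p \<in> generated_equiv A \<longleftrightarrow> p \<in> generated_equiv B"
proof -
  have *: "AE p in m. p \<in> generated_equiv A \<longrightarrow> p \<in> generated_equiv B"
    if "A \<in> sets m" "AE p in m. p \<in> A \<longleftrightarrow> p \<in> B" for A B
  proof -
    \<comment> \<open>A constant sequence turns the eventual statement into plain inclusion.\<close>
    from that(2) have "AE p in m. p \<in> A \<longrightarrow> eventually (\<lambda>n. p \<in> B) sequentially"
      by eventually_elim simp
    from AE_eventually_generated_equiv[OF that(1) this] show ?thesis by eventually_elim simp
  qed
  have "AE p in m. p \<in> B \<longleftrightarrow> p \<in> A" using assms(3) by eventually_elim auto
  from *[OF assms(1,3)] *[OF assms(2) this] show ?thesis by eventually_elim auto
qed

text \<open>Off an invariant null set \<open>P\<close> all of \<open>R\<close> is covered by the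
  graphs, so composing with the edges preserves Borel sets. Over \<open>P\<close> the relation is
  replaced by the diagonal, which keeps \<open>S\<close> an equivalence relation.\<close>

lemma generated_equiv_AE_borel:
  assumes A: "A \<in> sets m"
  obtains S where "S \<in> sets borel" "equiv UNIV S" "S \<subseteq> R" "AE p in m. p \<in> S \<longleftrightarrow> p \<in> generated_equiv A"
proof -
  obtain K :: "nat \<Rightarrow> ('a \<times> 'a) set"
    where "\<forall>n. compact (K n) \<and> K n \<subseteq> R \<and> inj_on fst (K n)" and K3: "R - (\<Union>n. K n) \<in> null_sets m"
    using exists_graph_cover by blast
  then have K: "compact (K n)" "inj_on fst (K n)" for n by auto
  have AR: "A \<subseteq> R" using A by (simp add: sets_m)
  obtain P where P: "P \<in> sets borel" "R `` P \<subseteq> P" "fst ` (R - (\<Union>n. K n)) \<subseteq> P"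
    "R \<inter> (P \<times> UNIV) \<in> null_sets m" by (rule null_invariant_domain[OF K3])
  define E where "E = (A \<union> converse A) \<inter> ((- P) \<times> UNIV)"
  define S where "S = Id \<union> (generated_equiv A \<inter> ((- P) \<times> UNIV))"
  have E: "E \<in> sets borel"
    unfolding E_def using A converse_sets[OF A] P(1) borel_Times[of "- P" UNIV] by (auto simp: sets_m)
  have EK: "E \<subseteq> (\<Union>n. K n)" 
  proof
    fix p assume p: "p \<in> E"
    then have "p \<in> R" "fst p \<notin> P" using AR R_sym unfolding E_def by auto
    moreover have "fst p \<in> P" if "p \<in> R - (\<Union>n. K n)" using P(3) that by blast
    ultimately show "p \<in> (\<Union>n. K n)" by blast
  qed
  have Id: "(Id :: ('a \<times> 'a) set) \<in> sets borel"
  proof -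
    have eq: "(Id :: ('a \<times> 'a) set) = {y. \<exists>x. y = (x, x)}" by auto
    have "closed (Id :: ('a \<times> 'a) set)" unfolding eq by (rule closed_diagonal)
    then show ?thesis by (rule borel_closed)
  qed
  have En: "E ^^ n \<in> sets borel" for n
  proof (induction n)
    case 0
    then show ?case using Id by simp
  next
    case (Suc n)
    \<comment> \<open>Powers are defined by composing on the right; commuting puts \<open>E\<close>,
      the factor covered by graphs, on the left.\<close>
    then show ?case using relcomp_borel[OF K E EK] by (simp flip: relpow_commute)
  qed
  have "generated_equiv A \<inter> ((- P) \<times> UNIV) = E\<^sup>* \<inter> ((- P) \<times> UNIV)"
  proof safe
    fix x y assume xy: "(x, y) \<in> generated_equiv A" "x \<notin> P"
    from xy(1) show "(x, y) \<in> E\<^sup>*"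
      unfolding generated_equiv_eq_rtrancl
    proof (induction rule: rtrancl_induct)
      case (step y z)
      have "(x, y) \<in> R"
        using generated_equiv_subset[OF AR] step.hyps(1) by (auto simp: generated_equiv_eq_rtrancl)
      then have "y \<notin> P" using invariant_iff[OF P(2)] xy(2) by blast
      then have "(y, z) \<in> E" using step.hyps(2) by (simp add: E_def)
      with step.IH show ?case by (rule rtrancl_into_rtrancl)
    qed simp
  next
    fix x y assume "(x, y) \<in> E\<^sup>*"
    moreover have "E\<^sup>* \<subseteq> generated_equiv A"
      unfolding generated_equiv_eq_rtrancl by (rule rtrancl_mono) (auto simp: E_def)
    ultimately show "(x, y) \<in> generated_equiv A" by blast
  qed
  then have "S = Id \<union> ((\<Union>n. E ^^ n) \<inter> ((- P) \<times> UNIV))"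
    by (simp add: S_def rtrancl_is_UN_relpow)
  then have Sb: "S \<in> sets borel" using Id En P(1) borel_Times[of "- P" UNIV] by auto
  have GR: "generated_equiv A \<subseteq> R" using AR by (rule generated_equiv_subset)
  have geq: "equiv UNIV (generated_equiv A)"
    unfolding generated_equiv_eq_rtrancl
    by (intro equivI sym_rtrancl) (auto simp: refl_on_def trans_rtrancl sym_Un_converse)
  have Seq: "equiv UNIV S"
  proof (rule equivI)
    show "refl S" by (auto simp: S_def refl_on_def)
    show "sym S"
      using geq GR invariant_iff[OF P(2)] by (auto simp: S_def sym_def equiv_def)
    show "trans S"
      using geq unfolding S_def equiv_def trans_def by blast
  qed auto
  have SR: "S \<subseteq> R" using GR R_refl by (auto simp: S_def)
  show thesis
  proof (rule that[OF Sb Seq SR], rule AE_I'[OF P(4)])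
    show "{p \<in> space m. (p \<in> S) \<noteq> (p \<in> generated_equiv A)} \<subseteq> R \<inter> P \<times> UNIV"
      using geq by (auto simp: S_def space_m equiv_def refl_on_def)
  qed
qed

text \<open>Borel representatives \<open>S\<close> and \<open>S'\<close> stand in for the generated
  relations, which are known to be Borel only up to null sets; \<open>measure\<close> of a
  non-measurable set would default to zero.\<close>

lemma generated_equiv_lower_continuous:
  assumes A: "A \<in> sets m" and S: "S \<in> sets m" "AE p in m. p \<in> S \<longleftrightarrow> p \<in> generated_equiv A"
    and "\<epsilon> > 0"
  obtains \<delta> where "\<delta> > 0" "\<And>B S'. B \<in> sets m \<Longrightarrow> S' \<in> sets m \<Longrightarrow>
    AE p in m. p \<in> S' \<longleftrightarrow> p \<in> generated_equiv B \<Longrightarrow> measure m (A - B) < \<delta> \<Longrightarrow> measure m (S - S') < \<epsilon>"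
proof (rule ccontr)
  assume *: "\<not> thesis"
  \<comment> \<open>Radii \<open>(1/2)^n\<close> make the measures summable, as Borel-Cantelli
    requires.\<close>
  have "\<exists>B S'. B \<in> sets m \<and> S' \<in> sets m \<and> (AE p in m. p \<in> S' \<longleftrightarrow> p \<in> generated_equiv B) \<and>
    measure m (A - B) < (1/2)^n \<and> measure m (S - S') \<ge> \<epsilon>" for n
    using * that[of "(1/2)^n"] by (force simp: not_less)
  then have "\<forall>n. \<exists>p. fst p \<in> sets m \<and> snd p \<in> sets m \<and>
    (AE q in m. q \<in> snd p \<longleftrightarrow> q \<in> generated_equiv (fst p)) \<and>
    measure m (A - fst p) < (1/2)^n \<and> measure m (S - snd p) \<ge> \<epsilon>" by simp
  from choice[OF this] obtain p where p: "\<forall>n. fst (p n) \<in> sets m \<and> snd (p n) \<in> sets m \<and>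
    (AE q in m. q \<in> snd (p n) \<longleftrightarrow> q \<in> generated_equiv (fst (p n))) \<and>
    measure m (A - fst (p n)) < (1/2)^n \<and> measure m (S - snd (p n)) \<ge> \<epsilon>" ..
  define B where "B n = fst (p n)" for n
  define S' where "S' n = snd (p n)" for n
  have B: "\<And>n. B n \<in> sets m" "\<And>n. measure m (A - B n) < (1/2)^n"
    and S': "\<And>n. S' n \<in> sets m" "\<And>n. AE p in m. p \<in> S' n \<longleftrightarrow> p \<in> generated_equiv (B n)"
      "\<And>n. measure m (S - S' n) \<ge> \<epsilon>"
    using p by (simp_all add: B_def S'_def)
  have "AE p in m. eventually (\<lambda>n. p \<in> space m - (A - B n)) sequentially"
  proof (rule borel_cantelli_AE1)
    show "summable (\<lambda>n. measure m (A - B n))"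
    proof (rule summable_comparison_test)
      show "\<exists>N. \<forall>n\<ge>N. norm (measure m (A - B n)) \<le> (1/2)^n" using B(2) by (auto intro: less_imp_le)
    qed (simp add: summable_geometric)
  qed (use A B(1) emeasure_finite in \<open>auto simp: less_top[symmetric]\<close>)
  then have "AE p in m. p \<in> A \<longrightarrow> eventually (\<lambda>n. p \<in> B n) sequentially"
    by eventually_elim (auto elim: eventually_mono)
  then have "AE p in m. p \<in> generated_equiv A \<longrightarrow> eventually (\<lambda>n. p \<in> generated_equiv (B n)) sequentially"
    by (rule AE_eventually_generated_equiv[OF A])
  moreover have "AE p in m. \<forall>n. p \<in> S' n \<longleftrightarrow> p \<in> generated_equiv (B n)"
    using S'(2) by (simp add: AE_all_countable)
  ultimately have "AE p in m. p \<in> S \<longrightarrow> eventually (\<lambda>n. p \<in> S' n) sequentially"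
    using S(2) by eventually_elim auto
  \<comment> \<open>A point of all \<open>G n\<close> lies in \<open>S\<close> but outside
    infinitely many \<open>S' k\<close>; almost no point does, yet each \<open>G n\<close> has
    measure at least \<epsilon>.\<close>
  moreover define G where "G n = (\<Union>k\<in>{n..}. S - S' k)" for n
  have Gs: "G n \<in> sets m" for n unfolding G_def using S S' by auto
  ultimately have "AE p in m. p \<notin> (\<Inter>n. G n)"
    by (elim AE_mp) (auto simp: G_def eventually_sequentially intro!: AE_I2)
  then have "(\<Inter>n. G n) \<in> null_sets m" using Gs by (subst AE_iff_null_sets) auto
  moreover have "(\<lambda>n. measure m (G n)) \<longlonglongrightarrow> measure m (\<Inter>n. G n)"
    using Gs by (intro finite_Lim_measure_decseq) (auto simp: G_def decseq_def)
  ultimately have "(\<lambda>n. measure m (G n)) \<longlonglongrightarrow> 0" by (simp add: measure_def null_setsD1)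
  moreover have "\<epsilon> \<le> measure m (G n)" for n
  proof -
    have "measure m (S - S' n) \<le> measure m (G n)"
      using Gs by (intro finite_measure_mono) (auto simp: G_def)
    then show ?thesis using S'(3)[of n] by linarith
  qed
  ultimately have "\<epsilon> \<le> 0" by (intro LIMSEQ_le_const) auto
  then show False using \<open>\<epsilon> > 0\<close> by simp
qed

section \<open>Passage to classes\<close>

lemma mclass_rel_measure: "mclass (rel_measure \<mu> R) = mclass m"
  using sets_eq null_eq by (intro mclass_cong) auto

lemma malg_rel_measure: "malg (rel_measure \<mu> R) = malg m"
  by (simp add: malg_def mclass_rel_measure sets_eq)

text \<open>Almost equal sets generate almost equal relations, so the set of candidate classes is a
  singleton and \<open>the_elem\<close> returns its member. \<open>S\<close> is needed because
  \<open>mclass_eq_iff\<close> wants a measurable left side.\<close>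

lemma generate_map_mclass:
  assumes "A \<in> sets m"
  shows "generate_map \<mu> R (mclass m A) = mclass m (generated_equiv A)"
proof -
  obtain S where S: "S \<in> sets m" "AE p in m. p \<in> S \<longleftrightarrow> p \<in> generated_equiv A"
    by (rule generated_equiv_AE_borel[OF assms]) (simp add: sets_m)
  have "mclass m (generated_equiv B) = mclass m (generated_equiv A)" if B: "B \<in> mclass m A" for B
  proof -
    have "B \<in> sets m" "AE p in m. p \<in> B \<longleftrightarrow> p \<in> A" using B by (auto simp: mclass_def)
    then have "AE p in m. p \<in> generated_equiv B \<longleftrightarrow> p \<in> generated_equiv A"
      using assms by (intro AE_generated_equiv_cong)
    with S(2) have "AE p in m. p \<in> S \<longleftrightarrow> p \<in> generated_equiv B" by eventually_elim auto
    then show ?thesis using S mclass_eq_iff[OF S(1)] by metis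
  qed
  then have "(\<lambda>A. mclass m (generated_equiv A)) ` mclass m A = {mclass m (generated_equiv A)}"
    using mclass_self[OF assms] by blast
  then show ?thesis by (simp add: generate_map_def mclass_rel_measure)
qed

lemma generate_map_Sub:
  assumes "a \<in> malg m"
  shows "generate_map \<mu> R a \<in> Sub \<mu> R"
proof -
  obtain A where A: "A \<in> sets m" "a = mclass m A" using assms by (auto simp: malg_def)
  obtain S where S: "S \<in> sets borel" "equiv UNIV S" "S \<subseteq> R" "AE p in m. p \<in> S \<longleftrightarrow> p \<in> generated_equiv A"
    using generated_equiv_AE_borel[OF A(1)] by blast
  then have "generate_map \<mu> R a = mclass m S"
    using A mclass_eq_iff[of S m "generated_equiv A"] by (simp add: generate_map_mclass sets_m)
  then show ?thesis using S unfolding Sub_def mclass_rel_measure by blast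
qed

lemma Sub_subset_malg: "Sub \<mu> R \<subseteq> malg m"
  unfolding Sub_def malg_def mclass_rel_measure by (auto simp: sets_m)

lemma generate_map_lower_continuous:
  assumes a: "a \<in> malg m" and "\<epsilon> > 0"
  obtains \<delta> where "\<delta> > 0" "\<And>b. b \<in> malg m \<Longrightarrow> lower_excess m a b < \<delta> \<Longrightarrow>
    lower_excess m (generate_map \<mu> R a) (generate_map \<mu> R b) < \<epsilon>"
proof -
  have ex: "\<exists>S\<in>sets m. (AE p in m. p \<in> S \<longleftrightarrow> p \<in> generated_equiv A) \<and> generate_map \<mu> R (mclass m A) = mclass m S"
    if A: "A \<in> sets m" for A
  proof -
    obtain S where "S \<in> sets m" "AE p in m. p \<in> S \<longleftrightarrow> p \<in> generated_equiv A"
      by (rule generated_equiv_AE_borel[OF A]) (simp add: sets_m)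
    then show ?thesis using A mclass_eq_iff[of S m] by (metis generate_map_mclass)
  qed
  obtain A where A: "A \<in> sets m" "a = mclass m A" using a by (auto simp: malg_def)
  obtain S where S: "S \<in> sets m" "AE p in m. p \<in> S \<longleftrightarrow> p \<in> generated_equiv A"
    "generate_map \<mu> R a = mclass m S" using ex[OF A(1)] A(2) by blast
  obtain \<delta> where \<delta>: "\<delta> > 0" "\<And>B S'. B \<in> sets m \<Longrightarrow> S' \<in> sets m \<Longrightarrow>
    AE p in m. p \<in> S' \<longleftrightarrow> p \<in> generated_equiv B \<Longrightarrow> measure m (A - B) < \<delta> \<Longrightarrow> measure m (S - S') < \<epsilon>"
    using generated_equiv_lower_continuous[OF A(1) S(1,2) \<open>\<epsilon> > 0\<close>] by blast
  show thesis
  proof (rule that[OF \<delta>(1)])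
    fix b assume b: "b \<in> malg m" "lower_excess m a b < \<delta>"
    obtain B where B: "B \<in> sets m" "b = mclass m B" using b by (auto simp: malg_def)
    obtain S' where S': "S' \<in> sets m" "AE p in m. p \<in> S' \<longleftrightarrow> p \<in> generated_equiv B"
      "generate_map \<mu> R b = mclass m S'" using ex[OF B(1)] B(2) by blast
    have "measure m (S - S') < \<epsilon>"
      using b(2) A B by (intro \<delta>(2)[OF B(1) S'(1,2)]) (simp add: lower_excess_mclass)
    then show "lower_excess m (generate_map \<mu> R a) (generate_map \<mu> R b) < \<epsilon>"
      using S S' by (simp add: lower_excess_mclass)
  qed
qed

end


section \<open>Lower and strong topology of a separable measure algebra\<close>

lemma countable_closure_algebra:
  fixes G :: "'b set set"
  assumes "countable G"
  obtains \<C> where "countable \<C>" "G \<subseteq> \<C>" "{} \<in> \<C>" "\<And>A. A \<in> \<C> \<Longrightarrow> \<Omega> - A \<in> \<C>"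
    "\<And>A B. A \<in> \<C> \<Longrightarrow> B \<in> \<C> \<Longrightarrow> A \<union> B \<in> \<C>"
    "\<And>\<F>. sigma_algebra \<Omega> \<F> \<Longrightarrow> G \<subseteq> \<F> \<Longrightarrow> \<C> \<subseteq> \<F>"
proof -
  define L where "L = rec_nat (insert {} G)
     (\<lambda>_ \<D>. \<D> \<union> (\<lambda>A. \<Omega> - A) ` \<D> \<union> (\<lambda>(A, B). A \<union> B) ` (\<D> \<times> \<D>))"
  have L: "L 0 = insert {} G" "L (Suc n) = L n \<union> (\<lambda>A. \<Omega> - A) ` L n \<union> (\<lambda>(A, B). A \<union> B) ` (L n \<times> L n)" for n
    by (simp_all add: L_def)
  have "countable (L n)" for n by (induction n) (use assms in \<open>auto simp: L\<close>)
  moreover have mono: "n \<le> k \<Longrightarrow> L n \<subseteq> L k" for n k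
    by (rule lift_Suc_mono_le[of L]) (auto simp: L)
  moreover have "A \<union> B \<in> (\<Union>n. L n)" if "A \<in> (\<Union>n. L n)" "B \<in> (\<Union>n. L n)" for A B
  proof -
    obtain i j where "A \<in> L i" "B \<in> L j" using \<open>A \<in> (\<Union>n. L n)\<close> \<open>B \<in> (\<Union>n. L n)\<close> by blast
    then have "A \<in> L (max i j)" "B \<in> L (max i j)" using mono[of i "max i j"] mono[of j "max i j"] by auto
    then have "(A, B) \<in> L (max i j) \<times> L (max i j)" by blast
    then have "A \<union> B \<in> L (Suc (max i j))" unfolding L by (auto intro: rev_image_eqI)
    then show ?thesis by blast
  qed
  moreover have "\<Omega> - A \<in> (\<Union>n. L n)" if "A \<in> (\<Union>n. L n)" for A
  proof -
    obtain i where "A \<in> L i" using \<open>A \<in> (\<Union>n. L n)\<close> by blast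
    then have "\<Omega> - A \<in> L (Suc i)" unfolding L by blast
    then show ?thesis by blast
  qed
  moreover have "(\<Union>n. L n) \<subseteq> \<F>" if "sigma_algebra \<Omega> \<F>" "G \<subseteq> \<F>" for \<F>
  proof -
    interpret sigma_algebra \<Omega> \<F> by fact
    have "L n \<subseteq> \<F>" for n by (induction n) (use \<open>G \<subseteq> \<F>\<close> in \<open>auto simp: L\<close>)
    then show ?thesis by blast
  qed
  moreover have "insert {} G \<subseteq> (\<Union>n. L n)" using L(1) by blast
  ultimately show thesis by (intro that[of "\<Union>n. L n"]) auto
qed

lemma topspace_lower_topology: "topspace (lower_topology \<A> m) = \<A>"
proof
  show "topspace (lower_topology \<A> m) \<subseteq> \<A>"
    using openin_topspace[of "lower_topology \<A> m"] unfolding openin_lower_topology by blast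
  have "openin (lower_topology \<A> m) \<A>"
    unfolding openin_lower_topology by (auto intro: exI[of _ 1])
  then show "\<A> \<subseteq> topspace (lower_topology \<A> m)" by (rule openin_subset)
qed

context finite_measure
begin

text \<open>The sets approximable from the countable algebra \<C> generated by \<open>G\<close> form
  a sigma-algebra containing \<open>G\<close>.\<close>

lemma countable_dense_sets:
  assumes G: "countable G" "G \<subseteq> sets M" "sets M = sigma_sets (space M) G"
  obtains \<C> where "countable \<C>" "\<C> \<subseteq> sets M"
    "\<And>A e. A \<in> sets M \<Longrightarrow> e > 0 \<Longrightarrow> \<exists>C\<in>\<C>. measure M (sym_diff A C) < e"
proof -
  obtain \<C> where \<C>: "countable \<C>" "G \<subseteq> \<C>" "{} \<in> \<C>" "\<And>A. A \<in> \<C> \<Longrightarrow> space M - A \<in> \<C>"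
    "\<And>A B. A \<in> \<C> \<Longrightarrow> B \<in> \<C> \<Longrightarrow> A \<union> B \<in> \<C>"
    "\<And>\<F>. sigma_algebra (space M) \<F> \<Longrightarrow> G \<subseteq> \<F> \<Longrightarrow> \<C> \<subseteq> \<F>"
    using countable_closure_algebra[OF G(1), of "space M"] by metis
  have \<C>M: "\<C> \<subseteq> sets M" using \<C>(6)[OF sets.sigma_algebra_axioms G(2)] .
  have UN: "(\<Union>i<n. C i) \<in> \<C>" if "\<And>i. C i \<in> \<C>" for C and n :: nat
    by (induction n) (use \<C>(3,5) that in \<open>auto simp: lessThan_Suc\<close>)
  have approx: "\<forall>e>0. \<exists>C\<in>\<C>. measure M (sym_diff A C) < e" if "A \<in> sigma_sets (space M) G" for A
    using that
  proof induction
    case (Basic A)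
    then show ?case using \<C>(2) by (intro allI impI bexI[of _ A]) auto
  next
    case Empty
    then show ?case using \<C>(3) by (intro allI impI bexI[of _ "{}"]) auto
  next
    case (Compl A)
    show ?case
    proof (intro allI impI)
      fix e :: real assume "e > 0"
      then obtain C where C: "C \<in> \<C>" "measure M (sym_diff A C) < e" using Compl.IH by blast
      have "A \<subseteq> space M" "C \<subseteq> space M"
        using Compl.hyps G(3) \<C>M C(1) sets.sets_into_space by blast+
      then have "sym_diff (space M - A) (space M - C) = sym_diff A C" by blast
      then show "\<exists>C\<in>\<C>. measure M (sym_diff (space M - A) C) < e"
        using C \<C>(4) by (intro bexI[of _ "space M - C"]) auto
    qed
  next
    case (Union A)
    have As: "A i \<in> sets M" for i using Union.hyps G(3) by simp
    show ?case
    proof (intro allI impI)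
      fix e :: real assume "e > 0"
      have "(\<lambda>n. measure M (\<Union>i<n. A i)) \<longlonglongrightarrow> measure M (\<Union>n. \<Union>i<n. A i)"
        using As by (intro finite_Lim_measure_incseq) (auto simp: incseq_def, fastforce)
      moreover have "(\<Union>n. \<Union>i<n. A i) = (\<Union>i. A i)" by blast
      ultimately have "\<forall>\<^sub>F n in sequentially. dist (measure M (\<Union>i<n. A i)) (measure M (\<Union>i. A i)) < e / 2"
        using \<open>e > 0\<close> tendstoD[of _ "measure M (\<Union>i. A i)" sequentially "e / 2"] by simp
      then obtain n where "dist (measure M (\<Union>i<n. A i)) (measure M (\<Union>i. A i)) < e / 2"
        by (auto simp: eventually_sequentially)
      moreover have "measure M ((\<Union>i. A i) - (\<Union>i<n. A i)) = measure M (\<Union>i. A i) - measure M (\<Union>i<n. A i)"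
        using As by (intro finite_measure_Diff) auto
      ultimately have n: "measure M ((\<Union>i. A i) - (\<Union>i<n. A i)) < e / 2"
        unfolding dist_real_def by linarith
      \<comment> \<open>Half of \<open>e\<close> pays for truncating the union, the rest is shared
        by \<open>n\<close> approximations; \<open>Suc n\<close> avoids a division by zero when
        \<open>n\<close> is 0.\<close>
      define d where "d = e / (2 * real (Suc n))"
      have "d > 0" using \<open>e > 0\<close> by (simp add: d_def)
      then have "\<forall>i. \<exists>C\<in>\<C>. measure M (sym_diff (A i) C) < d" using Union.IH by blast
      then obtain C where C: "\<And>i. C i \<in> \<C>" "\<And>i. measure M (sym_diff (A i) (C i)) < d" by metis
      have Cs: "C i \<in> sets M" for i using C \<C>M by blast
      have "measure M (sym_diff (\<Union>i. A i) (\<Union>i<n. C i))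
          \<le> measure M (((\<Union>i. A i) - (\<Union>i<n. A i)) \<union> (\<Union>i<n. sym_diff (A i) (C i)))"
        using As Cs by (intro finite_measure_mono) auto
      also have "\<dots> \<le> measure M ((\<Union>i. A i) - (\<Union>i<n. A i)) + measure M (\<Union>i<n. sym_diff (A i) (C i))"
        using As Cs by (intro measure_Un_le) auto
      also have "measure M (\<Union>i<n. sym_diff (A i) (C i)) \<le> (\<Sum>i<n. measure M (sym_diff (A i) (C i)))"
        using As Cs by (intro measure_UNION_le) auto
      also have "\<dots> \<le> (\<Sum>i<n. d)" using C(2) by (intro sum_mono) (simp add: less_imp_le)
      also have "(\<Sum>i<n. d) \<le> e / 2" using \<open>e > 0\<close> by (simp add: d_def field_simps)
      finally have "measure M (sym_diff (\<Union>i. A i) (\<Union>i<n. C i)) < e" using n by linarith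
      then show "\<exists>C\<in>\<C>. measure M (sym_diff (\<Union>i. A i) C) < e" using UN[of C n] C(1) by blast
    qed
  qed
  show thesis by (rule that[OF \<C>(1) \<C>M]) (use approx G(3) in auto)
qed

section \<open>Excess, distance and semicontinuity\<close>

lemma rep_malg: "a \<in> malg M \<Longrightarrow> rep a \<in> sets M"
  using rep_mclass by (auto simp: malg_def mclass_def)

lemma malg_dist_eq_lower_excess:
  assumes "a \<in> malg M" "b \<in> malg M"
  shows "malg_dist M a b = lower_excess M a b + lower_excess M b a"
  unfolding malg_dist_def lower_excess_def
  using assms rep_malg by (intro finite_measure_Union) auto

lemma lower_excess_triangle:
  assumes "a \<in> malg M" "b \<in> malg M" "c \<in> malg M"
  shows "lower_excess M a c \<le> lower_excess M a b + lower_excess M b c"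
proof -
  have s: "rep a \<in> sets M" "rep b \<in> sets M" "rep c \<in> sets M" using assms rep_malg by auto
  have "measure M (rep a - rep c) \<le> measure M ((rep a - rep b) \<union> (rep b - rep c))"
    using s by (intro finite_measure_mono) auto
  also have "\<dots> \<le> measure M (rep a - rep b) + measure M (rep b - rep c)"
    using s by (intro measure_Un_le) auto
  finally show ?thesis by (simp add: lower_excess_def)
qed

lemma lower_excess_nonneg: "0 \<le> lower_excess M a b"
  by (simp add: lower_excess_def)

lemma openin_lower_imp_strong:
  assumes "openin (lower_topology (malg M) M) U"
  shows "openin (strong_topology (malg M) M) U"
proof -
  interpret S: Metric_space "malg M" "malg_dist M" by (rule Metric_space_malg)
  show ?thesis
    unfolding strong_topology_def S.openin_mtopology
  proof (intro conjI allI impI)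
    show "U \<subseteq> malg M" using assms by (simp add: openin_lower_topology)
    fix a assume "a \<in> U"
    then obtain e where e: "e > 0" "{b \<in> malg M. lower_excess M a b < e} \<subseteq> U"
      using assms unfolding openin_lower_topology by blast
    have "S.mball a e \<subseteq> U"
    proof
      fix b assume "b \<in> S.mball a e"
      then have "a \<in> malg M" "b \<in> malg M" "malg_dist M a b < e" by auto
      then show "b \<in> U" using e(2) malg_dist_eq_lower_excess[of a b] lower_excess_nonneg[of b a] by force
    qed
    then show "\<exists>r>0. S.mball a r \<subseteq> U" using e(1) by blast
  qed
qed

text \<open>By the triangle inequality the excess over \<open>c\<close> drops by at most
  \<open>lower_excess M b b'\<close> on passing from \<open>b\<close> to \<open>b'\<close>. Sublevel
  sets in the first argument are therefore lower closed, while strict ones in the second are lower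
  open.\<close>

lemma openin_lower_excess_greater:
  assumes "c \<in> malg M"
  shows "openin (lower_topology (malg M) M) {b \<in> malg M. lower_excess M b c > r}"
  unfolding openin_lower_topology
proof (intro conjI ballI)
  fix b assume b: "b \<in> {b \<in> malg M. lower_excess M b c > r}"
  have "lower_excess M b' c > r" if "b' \<in> malg M" "lower_excess M b b' < lower_excess M b c - r" for b'
    using lower_excess_triangle[of b b' c] b that assms by simp
  then show "\<exists>\<epsilon>>0. {b' \<in> malg M. lower_excess M b b' < \<epsilon>} \<subseteq> {b \<in> malg M. lower_excess M b c > r}"
    using b by (intro exI[of _ "lower_excess M b c - r"]) auto
qed auto

text \<open>A metric ball is a countable union of intersections of a lower open with a lower closed set, since
  the two halves of \<open>malg_dist\<close> are upper and lower semicontinuous for the lower topology.\<close>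

lemma lower_continuous_imp_fsigma_vimage:
  assumes G: "countable G" "G \<subseteq> sets M" "sets M = sigma_sets (space M) G"
    and f: "continuous_map (lower_topology (malg M) M) (lower_topology (malg M) M) f"
    and V: "openin (strong_topology (malg M) M) V"
  shows "fsigma_in (strong_topology (malg M) M) {a \<in> malg M. f a \<in> V}"
proof -
  interpret S: Metric_space "malg M" "malg_dist M" by (rule Metric_space_malg)
  let ?S = "strong_topology (malg M) M" and ?L = "lower_topology (malg M) M"
  have top: "topspace ?S = malg M" by (simp add: strong_topology_def)
  have fM: "f a \<in> malg M" if "a \<in> malg M" for a
    using f that by (auto simp: continuous_map_def topspace_lower_topology)
  have vim: "openin ?S {a \<in> malg M. f a \<in> U}" if "openin ?L U" for U
    using openin_continuous_map_preimage[OF f that]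
    by (intro openin_lower_imp_strong) (simp add: topspace_lower_topology)
  obtain \<C> where \<C>: "countable \<C>" "\<C> \<subseteq> sets M"
    "\<And>A e. A \<in> sets M \<Longrightarrow> e > 0 \<Longrightarrow> \<exists>C\<in>\<C>. measure M (sym_diff A C) < e"
    using countable_dense_sets[OF G] by metis
  have \<C>m: "mclass M C \<in> malg M" if "C \<in> \<C>" for C using that \<C>(2) by (auto simp: malg_def)
  \<comment> \<open>A ball bounds a sum of two excesses by \<open>q\<close>; a rational
    \<open>r\<close> separates the two conditions. The weak inequality makes the second set closed,
    and the first keeps the sum strictly below \<open>q\<close>.\<close>
  define T where "T = (\<lambda>(C, q, r). {a \<in> malg M. lower_excess M (mclass M C) (f a) < r} \<inter>
      {a \<in> malg M. lower_excess M (f a) (mclass M C) \<le> q - r}) `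
    {(C, q, r). (C, q, r) \<in> \<C> \<times> \<rat> \<times> \<rat> \<and> S.mball (mclass M C) q \<subseteq> V}"
  have "countable T"
    unfolding T_def
  proof (rule countable_image, rule countable_subset)
    show "countable (\<C> \<times> (\<rat> :: real set) \<times> (\<rat> :: real set))"
      using \<C>(1) countable_rat by (intro countable_SIGMA)
  qed blast
  moreover have "fsigma_in ?S X" if "X \<in> T" for X
  proof -
    obtain C q r where C: "C \<in> \<C>" and X: "X = {a \<in> malg M. lower_excess M (mclass M C) (f a) < r} \<inter>
      {a \<in> malg M. lower_excess M (f a) (mclass M C) \<le> q - r}"
      using \<open>X \<in> T\<close> unfolding T_def by auto
    have "{a \<in> malg M. lower_excess M (mclass M C) (f a) < r}
        = {a \<in> malg M. f a \<in> {b \<in> malg M. lower_excess M (mclass M C) b < r}}" using fM by auto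
    then have "openin ?S {a \<in> malg M. lower_excess M (mclass M C) (f a) < r}"
      using vim[OF openin_lower_nbhd[OF \<C>m[OF C]]] by simp
    then have 1: "fsigma_in ?S {a \<in> malg M. lower_excess M (mclass M C) (f a) < r}"
      unfolding strong_topology_def by (intro open_imp_fsigma_in S.metrizable_space_mtopology)
    have "malg M - {a \<in> malg M. lower_excess M (f a) (mclass M C) \<le> q - r}
        = {a \<in> malg M. f a \<in> {b \<in> malg M. lower_excess M b (mclass M C) > q - r}}" using fM by auto
    then have "openin ?S (malg M - {a \<in> malg M. lower_excess M (f a) (mclass M C) \<le> q - r})"
      using vim[OF openin_lower_excess_greater[OF \<C>m[OF C]]] by simp
    then have "closedin ?S {a \<in> malg M. lower_excess M (f a) (mclass M C) \<le> q - r}"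
      by (auto simp: closedin_def top)
    then have 2: "fsigma_in ?S {a \<in> malg M. lower_excess M (f a) (mclass M C) \<le> q - r}"
      by (rule closed_imp_fsigma_in)
    show ?thesis unfolding X using 1 2 by (rule fsigma_in_Int)
  qed
  ultimately have "fsigma_in ?S (\<Union>T)" by (rule fsigma_in_Union)
  moreover have "\<Union>T = {a \<in> malg M. f a \<in> V}"
  proof (intro equalityI subsetI)
    fix a assume "a \<in> \<Union>T"
    then obtain C q r where C: "C \<in> \<C>" "S.mball (mclass M C) q \<subseteq> V" "a \<in> malg M"
      "lower_excess M (mclass M C) (f a) < r" "lower_excess M (f a) (mclass M C) \<le> q - r"
      unfolding T_def by auto
    then have "malg_dist M (mclass M C) (f a) < q"
      using malg_dist_eq_lower_excess[OF \<C>m[OF C(1)] fM[OF C(3)]] by linarith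
    then have "f a \<in> S.mball (mclass M C) q" using \<C>m fM C by simp
    then show "a \<in> {a \<in> malg M. f a \<in> V}" using C by blast
  next
    fix a assume "a \<in> {a \<in> malg M. f a \<in> V}"
    then have a: "a \<in> malg M" "f a \<in> V" by auto
    obtain e where e: "e > 0" "S.mball (f a) e \<subseteq> V"
      using V a(2) unfolding strong_topology_def S.openin_mtopology by blast
    obtain A where A: "A \<in> sets M" "f a = mclass M A" using fM[OF a(1)] by (auto simp: malg_def)
    obtain C where C: "C \<in> \<C>" "measure M (sym_diff A C) < e / 3" using \<C>(3)[OF A(1), of "e / 3"] e(1) by auto
    have Cs: "C \<in> sets M" using C \<C>(2) by blast
    have d: "malg_dist M (f a) (mclass M C) < e / 3" using C(2) A Cs by (simp add: malg_dist_mclass)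
    \<comment> \<open>\<open>q > e / 3\<close> puts \<open>f a\<close> into the ball about the class
      of \<open>C\<close>, and \<open>q < e / 2\<close> keeps that ball inside the one of radius
      \<open>e\<close> about \<open>f a\<close>.\<close>
    obtain q where q: "q \<in> \<rat>" "e / 3 < q" "q < e / 2" using Rats_dense_in_real[of "e / 3" "e / 2"] e(1) by auto
    have sub: "S.mball (mclass M C) q \<subseteq> V"
    proof
      fix b assume "b \<in> S.mball (mclass M C) q"
      then have b: "b \<in> malg M" "malg_dist M (mclass M C) b < q" by auto
      have "malg_dist M (f a) b \<le> malg_dist M (f a) (mclass M C) + malg_dist M (mclass M C) b"
        using fM a b \<C>m[OF C(1)] by (intro S.triangle) auto
      then have "b \<in> S.mball (f a) e" using d b q fM a e(1) by simp
      then show "b \<in> V" using e(2) by blast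
    qed
    have "lower_excess M (mclass M C) (f a) + lower_excess M (f a) (mclass M C) < q"
      using d q malg_dist_eq_lower_excess[OF fM[OF a(1)] \<C>m[OF C(1)]] by linarith
    then obtain r where r: "r \<in> \<rat>" "lower_excess M (mclass M C) (f a) < r"
      "r < q - lower_excess M (f a) (mclass M C)"
      using Rats_dense_in_real[of "lower_excess M (mclass M C) (f a)" "q - lower_excess M (f a) (mclass M C)"] by auto
    show "a \<in> \<Union>T"
    proof (rule UnionI)
      show "{a \<in> malg M. lower_excess M (mclass M C) (f a) < r} \<inter>
        {a \<in> malg M. lower_excess M (f a) (mclass M C) \<le> q - r} \<in> T"
        unfolding T_def by (rule image_eqI[of _ _ "(C, q, r)"]) (use C(1) q(1) r(1) sub in auto)
    qed (use r a(1) in auto)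
  qed
  ultimately show ?thesis by simp
qed

end


section \<open>The generation map\<close>

context measured_relation
begin

text \<open>Traces on \<open>R\<close> of a countable basis suffice; this supplies the separability
  behind the F-sigma argument.\<close>

lemma sets_m_countably_generated:
  obtains G where "countable G" "G \<subseteq> sets m" "sets m = sigma_sets (space m) G"
proof -
  obtain \<B> :: "('a \<times> 'a) set set" where \<B>: "countable \<B>" "topological_basis \<B>"
    using ex_countable_basis by blast
  have borel: "sets (borel :: ('a \<times> 'a) measure) = sigma_sets UNIV \<B>"
    by (subst borel_eq_countable_basis[OF \<B>]) simp
  have "sets m = (\<inter>) R ` sets borel" using R_borel by (auto simp: sets_m)
  also have "\<dots> = sigma_sets R ((\<inter>) R ` \<B>)"
    unfolding borel using R_borel by (intro sigma_sets_Int) (auto simp: borel)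
  finally have eq: "sets m = sigma_sets (space m) ((\<inter>) R ` \<B>)" by (simp add: space_m)
  show thesis
  proof (rule that)
    show "(\<inter>) R ` \<B> \<subseteq> sets m" unfolding eq by (auto intro: sigma_sets.Basic)
  qed (use \<B>(1) eq in auto)
qed

lemma generate_map_continuous:
  "continuous_map (lower_topology (malg m) m) (lower_topology (malg m) m) (generate_map \<mu> R)"
proof -
  have "openin (lower_topology (malg m) m) {a \<in> malg m. generate_map \<mu> R a \<in> U}"
    if U: "openin (lower_topology (malg m) m) U" for U
    unfolding openin_lower_topology
  proof (intro conjI ballI)
    fix a assume "a \<in> {a \<in> malg m. generate_map \<mu> R a \<in> U}"
    then have a: "a \<in> malg m" "generate_map \<mu> R a \<in> U" by auto
    obtain e where e: "e > 0" "{b \<in> malg m. lower_excess m (generate_map \<mu> R a) b < e} \<subseteq> U"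
      using U a(2) unfolding openin_lower_topology by blast
    obtain d where d: "d > 0" "\<And>b. b \<in> malg m \<Longrightarrow> lower_excess m a b < d \<Longrightarrow>
      lower_excess m (generate_map \<mu> R a) (generate_map \<mu> R b) < e"
      using generate_map_lower_continuous[OF a(1) e(1)] by metis
    have "generate_map \<mu> R b \<in> U" if "b \<in> malg m" "lower_excess m a b < d" for b
      using e(2) d(2)[OF that] generate_map_Sub[OF that(1)] Sub_subset_malg by blast
    then show "\<exists>\<epsilon>>0. {b \<in> malg m. lower_excess m a b < \<epsilon>} \<subseteq> {a \<in> malg m. generate_map \<mu> R a \<in> U}"
      using d(1) by (intro exI[of _ d]) auto
  qed auto
  then show ?thesis
    using generate_map_Sub Sub_subset_malg
    by (auto simp: continuous_map_def topspace_lower_topology)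
qed

lemma generate_map_baire_class_one:
  "baire_class_one (strong_topology (malg m) m)
     (subtopology (strong_topology (malg m) m) (Sub \<mu> R)) (generate_map \<mu> R)"
proof -
  interpret S: Metric_space "malg m" "malg_dist m" by (rule Metric_space_malg)
  have top: "topspace (strong_topology (malg m) m) = malg m" by (simp add: strong_topology_def)
  obtain G where G: "countable G" "G \<subseteq> sets m" "sets m = sigma_sets (space m) G"
    by (rule sets_m_countably_generated)
  have "fsigma_in (strong_topology (malg m) m) {a \<in> malg m. generate_map \<mu> R a \<in> U}"
    if U: "openin (subtopology (strong_topology (malg m) m) (Sub \<mu> R)) U" for U
  proof -
    obtain V where V: "openin (strong_topology (malg m) m) V" "U = V \<inter> Sub \<mu> R"
      using U unfolding openin_subtopology by blast
    \<comment> \<open>The map takes values in \<open>Sub\<close>, so cutting \<open>V\<close> down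
      to it does not change the preimage.\<close>
    have "{a \<in> malg m. generate_map \<mu> R a \<in> U} = {a \<in> malg m. generate_map \<mu> R a \<in> V}"
      using V(2) generate_map_Sub by blast
    then show ?thesis
      using lower_continuous_imp_fsigma_vimage[OF G generate_map_continuous V(1)] by simp
  qed
  then show ?thesis
    using generate_map_Sub Sub_subset_malg by (auto simp: baire_class_one_def top)
qed

end

theorem proposition3p19:
  fixes \<mu> :: "'a::polish_space measure"
    and R :: "('a \<times> 'a) set"
    and m :: "('a \<times> 'a) measure"
  assumes "standard_prob_space \<mu>"
    and "countable_borel_equiv R"
    and "nonsingular \<mu> R"
    and "finite_measure m"
    and "sets m = sets (rel_measure \<mu> R)"
    and "null_sets m = null_sets (rel_measure \<mu> R)"
  shows "(\<forall>A \<in> sets (rel_measure \<mu> R).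
            generate_map \<mu> R (mclass (rel_measure \<mu> R) A)
              = mclass (rel_measure \<mu> R) (generated_equiv A))
       \<and> continuous_map
            (lower_topology (malg (rel_measure \<mu> R)) m)
            (subtopology (lower_topology (malg (rel_measure \<mu> R)) m) (Sub \<mu> R))
            (generate_map \<mu> R)
       \<and> baire_class_one
            (strong_topology (malg (rel_measure \<mu> R)) m)
            (subtopology (strong_topology (malg (rel_measure \<mu> R)) m) (Sub \<mu> R))
            (generate_map \<mu> R)"
proof -
  interpret measured_relation \<mu> R m by (rule measured_relation.intro[OF assms])
  show ?thesis
    unfolding malg_rel_measure mclass_rel_measure sets_eq[symmetric]
    using generate_map_mclass generate_map_continuous generate_map_Sub generate_map_baire_class_one
    by (auto simp: continuous_map_in_subtopology topspace_lower_topology)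
qed

end
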